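(* Let $q\ge 4$ be fixed, let $G$ be the path on vertices $1,\dots,n$, and let $\Omega$ be the set of proper $q$-colorings of $G$. Let $\mathcal{M}_{\rightarrow}$ be the systematic scan on $\Omega$. For any fixed $\varepsilon<1$ and all sufficiently large $n$, $$\mathrm{Mix}(\mathcal{M}_{\rightarrow},\varepsilon)\ \ge\ \tfrac12\left(\tfrac13\log_{q-1}n-2\right).$$
   Context: The $n$-vertex path has vertices $1,\dots,n$ and edges $\{i,i+1\}$. A $q$-coloring is a vector $\sigma=(\sigma_1,\dots,\sigma_n)\in\{0,\dots,q-1\}^n$; it is proper if adjacent vertices receive different colors. The procedure Metropolis($v$): choose a color $c\in\{0,\dots,q-1\}$ uniformly at random and propose recoloring $v$ with $c$; the proposal is accepted if and only if $c$ is not used at any neighbor of $v$ (otherwise the coloring is unchanged). One step of the Markov chain $\mathcal{M}_{\rightarrow}$ (systematic scan): for $v=1,2,\dots,n$ in this order, do Metropolis($v$) (with independent color choices). Its stationary distribution is uniform on $\Omega$. For a Markov chain $\mathcal{M}$ with transition matrix $P$ and stationary distribution $\pi$, $\mathrm{Mix}_x(\mathcal{M},\varepsilon)=\min\{t>0:\mathrm{d_{TV}}(P^t(x,\cdot),\pi(\cdot))\le\varepsilon\}$ and $\mathrm{Mix}(\mathcal{M},\varepsilon)=\max_x\mathrm{Mix}_x(\mathcal{M},\varepsilon)$, where $\mathrm{d_{TV}}(\theta_1,\theta_2)=\frac12\sum_i|\theta_1(i)-\theta_2(i)|$. *)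

theory Defs
  imports "HOL-Probability.Probability"
begin

definition path_edges :: "nat \<Rightarrow> nat set set" where
  "path_edges n = {{i, i + 1} | i. 1 \<le> i \<and> i + 1 \<le> n}"

text \<open>
  A coloring is a vector indexed by \<open>1, \<dots>, n\<close>; being extensional outside \<open>{1..n}\<close>, two colorings
  are equal as functions iff they are equal as vectors.
\<close>

definition colorings :: "nat \<Rightarrow> nat \<Rightarrow> (nat \<Rightarrow> nat) set" where
  "colorings n q = {1..n} \<rightarrow>\<^sub>E {0..<q}"

definition proper_colorings :: "nat \<Rightarrow> nat \<Rightarrow> (nat \<Rightarrow> nat) set" where
  "proper_colorings n q =
     {\<sigma> \<in> colorings n q. \<forall>u v. {u, v} \<in> path_edges n \<longrightarrow> \<sigma> u \<noteq> \<sigma> v}"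

definition metropolis :: "nat \<Rightarrow> nat \<Rightarrow> nat \<Rightarrow> (nat \<Rightarrow> nat) \<Rightarrow> (nat \<Rightarrow> nat) pmf" where
  "metropolis n q v \<sigma> =
     map_pmf (\<lambda>c. if \<forall>w. {v, w} \<in> path_edges n \<longrightarrow> \<sigma> w \<noteq> c then \<sigma>(v := c) else \<sigma>)
       (pmf_of_set {0..<q})"

definition systematic_scan :: "nat \<Rightarrow> nat \<Rightarrow> (nat \<Rightarrow> nat) \<Rightarrow> (nat \<Rightarrow> nat) pmf" where
  "systematic_scan n q \<sigma> =
     fold (\<lambda>v p. bind_pmf p (metropolis n q v)) [1..<n + 1] (return_pmf \<sigma>)"

text \<open>
  Markov chains on a finite state space \<open>S\<close> are given by transition kernels that map every
  \<open>x \<in> S\<close> to a distribution supported in \<open>S\<close>.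
\<close>

primrec kernel_power :: "('a \<Rightarrow> 'a pmf) \<Rightarrow> nat \<Rightarrow> 'a \<Rightarrow> 'a pmf" where
  "kernel_power K 0 x = return_pmf x"
| "kernel_power K (Suc t) x = bind_pmf (kernel_power K t x) K"

definition dTV :: "'a set \<Rightarrow> 'a pmf \<Rightarrow> 'a pmf \<Rightarrow> real" where
  "dTV S p r = 1 / 2 * (\<Sum>i\<in>S. \<bar>pmf p i - pmf r i\<bar>)"

text \<open>
  Mixing times are extended naturals: the infimum below is the minimum if the set is nonempty, and
  \<open>\<infinity>\<close> if the required distance is never reached (for instance if \<open>\<epsilon> < 0\<close>).
\<close>

definition Mix_from :: "'a set \<Rightarrow> ('a \<Rightarrow> 'a pmf) \<Rightarrow> 'a pmf \<Rightarrow> 'a \<Rightarrow> real \<Rightarrow> enat" where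
  "Mix_from S K \<pi> x \<epsilon> = Inf {enat t | t. t > 0 \<and> dTV S (kernel_power K t x) \<pi> \<le> \<epsilon>}"

definition Mix :: "'a set \<Rightarrow> ('a \<Rightarrow> 'a pmf) \<Rightarrow> 'a pmf \<Rightarrow> real \<Rightarrow> enat" where
  "Mix S K \<pi> \<epsilon> = Max ((\<lambda>x. Mix_from S K \<pi> x \<epsilon>) ` S)"

text \<open>
  The systematic scan is a chain on the finite nonempty set of proper colorings, and the uniform
  distribution on this set is stationary for it.
\<close>

lemma path_edges_iff:
  "{u, v} \<in> path_edges n \<longleftrightarrow>
     u \<in> {1..n} \<and> v \<in> {1..n} \<and> (v = u + 1 \<or> u = v + 1)"
  unfolding path_edges_def by (auto simp: doubleton_eq_iff)

lemma finite_proper_colorings: "finite (proper_colorings n q)"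
  unfolding proper_colorings_def colorings_def by (simp add: finite_PiE)

lemma proper_colorings_nonempty:
  assumes "q \<ge> 2"
  shows "proper_colorings n q \<noteq> {}"
proof -
  have "restrict (\<lambda>i. i mod 2) {1..n} \<in> proper_colorings n q"
    using assms less_le_trans[of "_ mod 2" 2 q] unfolding proper_colorings_def colorings_def
    by (auto simp: path_edges_iff) presburger+
  then show ?thesis by blast
qed

lemma metropolis_closed:
  assumes "q \<ge> 1" "v \<in> {1..n}" "\<sigma> \<in> proper_colorings n q"
  shows "set_pmf (metropolis n q v \<sigma>) \<subseteq> proper_colorings n q"
proof -
  have "\<sigma>(v := c) \<in> proper_colorings n q"
    if "c < q" "\<forall>w. {v, w} \<in> path_edges n \<longrightarrow> \<sigma> w \<noteq> c" for c
  proof -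
    have "\<sigma>(v := c) \<in> colorings n q"
      using assms(2,3) that(1) unfolding proper_colorings_def colorings_def
      by (auto simp: PiE_iff extensional_def)
    moreover have "(\<sigma>(v := c)) a \<noteq> (\<sigma>(v := c)) b" if "{a, b} \<in> path_edges n" for a b
    proof -
      have "a \<noteq> b" "\<sigma> a \<noteq> \<sigma> b" "{b, a} \<in> path_edges n"
        using that assms(3) by (auto simp: path_edges_iff proper_colorings_def)
      then show ?thesis
        using that \<open>\<forall>w. {v, w} \<in> path_edges n \<longrightarrow> \<sigma> w \<noteq> c\<close> by auto
    qed
    ultimately show ?thesis unfolding proper_colorings_def by blast
  qed
  then show ?thesis
    using assms unfolding metropolis_def by (auto simp: set_pmf_of_set)
qed

lemma metropolis_symmetric:
  assumes "q \<ge> 1" "\<sigma> \<in> proper_colorings n q" "\<tau> \<in> proper_colorings n q"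
    and v: "v \<in> {1..n}"
  shows "pmf (metropolis n q v \<sigma>) \<tau> = pmf (metropolis n q v \<tau>) \<sigma>"
proof (cases "\<sigma> = \<tau>")
  case False
  define acc where "acc = (\<lambda>\<sigma> c. \<forall>w. {v, w} \<in> path_edges n \<longrightarrow> \<sigma> w \<noteq> (c::nat))"
  have *: "pmf (metropolis n q v \<sigma>) \<tau> =
      (if \<forall>w. w \<noteq> v \<longrightarrow> \<sigma> w = \<tau> w then 1 / real q else 0)"
    if st: "\<sigma> \<in> proper_colorings n q" "\<tau> \<in> proper_colorings n q" "\<sigma> \<noteq> \<tau>" for \<sigma> \<tau>
  proof -
    have "{c \<in> {0..<q}. (if acc \<sigma> c then \<sigma>(v := c) else \<sigma>) = \<tau>} =
        (if \<forall>w. w \<noteq> v \<longrightarrow> \<sigma> w = \<tau> w then {\<tau> v} else {})" (is "?A = ?B")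
    proof (cases "\<forall>w. w \<noteq> v \<longrightarrow> \<sigma> w = \<tau> w")
      case True
      have "\<tau> v < q"
        using st(2) v unfolding proper_colorings_def colorings_def by (auto simp: PiE_iff)
      moreover have "acc \<sigma> (\<tau> v)"
        using st(2) True unfolding acc_def proper_colorings_def
        by (auto simp: path_edges_iff)
      moreover have "\<sigma>(v := \<tau> v) = \<tau>" using True by auto
      ultimately show ?thesis using True st(3) by (auto split: if_splits)
    next
      case False
      then show ?thesis using st(3) by (auto split: if_splits)
    qed
    moreover have "pmf (metropolis n q v \<sigma>) \<tau> = real (card ?A) / real q"
      using assms(1)
      by (simp add: metropolis_def pmf_map measure_pmf_of_set acc_def vimage_def
          Int_def conj_commute)
    ultimately have "pmf (metropolis n q v \<sigma>) \<tau> = real (card ?B) / real q"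
      by (simp only:)
    then show ?thesis by (cases "\<forall>w. w \<noteq> v \<longrightarrow> \<sigma> w = \<tau> w") (simp_all only: if_True if_False, simp_all)
  qed
  have "(\<forall>w. w \<noteq> v \<longrightarrow> \<sigma> w = \<tau> w) \<longleftrightarrow> (\<forall>w. w \<noteq> v \<longrightarrow> \<tau> w = \<sigma> w)"
    by metis
  then show ?thesis
    using *[OF assms(2,3) False] *[OF assms(3,2) False[symmetric]] by (simp only:)
qed simp

lemma metropolis_stationary:
  assumes "q \<ge> 2" and v: "v \<in> {1..n}"
  shows "bind_pmf (pmf_of_set (proper_colorings n q)) (metropolis n q v) =
    pmf_of_set (proper_colorings n q)" (is "bind_pmf (pmf_of_set ?S) ?K = _")
proof (rule pmf_eqI)
  fix y
  note fin = finite_proper_colorings[of n q]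
  note ne = proper_colorings_nonempty[OF assms(1), of n]
  have "pmf (bind_pmf (pmf_of_set ?S) ?K) y = (\<Sum>x\<in>?S. pmf (?K x) y) / card ?S"
    using fin ne by (simp add: pmf_bind integral_pmf_of_set)
  also have "(\<Sum>x\<in>?S. pmf (?K x) y) = (if y \<in> ?S then 1 else 0)"
  proof (cases "y \<in> ?S")
    case True
    have "(\<Sum>x\<in>?S. pmf (?K x) y) = (\<Sum>x\<in>?S. pmf (?K y) x)"
      using assms True by (intro sum.cong metropolis_symmetric) auto
    also have "\<dots> = 1"
      using assms True fin by (intro sum_pmf_eq_1 metropolis_closed) auto
    finally show ?thesis using True by simp
  next
    case False
    have "pmf (?K x) y = 0" if "x \<in> ?S" for x
      using metropolis_closed[OF _ v that] assms(1) False by (auto simp: pmf_eq_0_set_pmf)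
    then show ?thesis using False by simp
  qed
  also have "(if y \<in> ?S then 1 else 0) / card ?S = pmf (pmf_of_set ?S) y"
    using fin ne by simp
  finally show "pmf (bind_pmf (pmf_of_set ?S) ?K) y = pmf (pmf_of_set ?S) y" .
qed

lemma systematic_scan_closed:
  assumes "q \<ge> 1" "\<sigma> \<in> proper_colorings n q"
  shows "set_pmf (systematic_scan n q \<sigma>) \<subseteq> proper_colorings n q"
proof -
  have "set_pmf (fold (\<lambda>v p. bind_pmf p (metropolis n q v)) vs p) \<subseteq> proper_colorings n q"
    if "set vs \<subseteq> {1..n}" "set_pmf p \<subseteq> proper_colorings n q" for vs p
    using that
  proof (induction vs arbitrary: p)
    case (Cons v vs)
    have "set_pmf (bind_pmf p (metropolis n q v)) \<subseteq> proper_colorings n q"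
      using Cons.prems metropolis_closed[OF assms(1), of v n] by (fastforce simp: set_bind_pmf)
    with Cons show ?case by simp
  qed simp
  moreover have "set [1..<n + 1] \<subseteq> {1..n}" by auto
  moreover have "set_pmf (return_pmf \<sigma>) \<subseteq> proper_colorings n q" using assms(2) by simp
  ultimately show ?thesis unfolding systematic_scan_def .
qed

lemma systematic_scan_stationary:
  assumes "q \<ge> 2"
  shows "bind_pmf (pmf_of_set (proper_colorings n q)) (systematic_scan n q) =
    pmf_of_set (proper_colorings n q)" (is "bind_pmf ?\<pi> _ = _")
proof -
  let ?F = "fold (\<lambda>v p. bind_pmf p (metropolis n q v))"
  have bind: "bind_pmf r (\<lambda>x. ?F vs (f x)) = ?F vs (bind_pmf r f)"
    for vs and r :: "(nat \<Rightarrow> nat) pmf" and f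
    by (induction vs arbitrary: f) (simp_all add: bind_assoc_pmf)
  have "?F vs ?\<pi> = ?\<pi>" if "set vs \<subseteq> {1..n}" for vs
    using that by (induction vs) (simp_all add: metropolis_stationary[OF assms])
  moreover have "set [1..<n + 1] \<subseteq> {1..n}" by auto
  ultimately have "?F [1..<n + 1] ?\<pi> = ?\<pi>" .
  moreover have "bind_pmf ?\<pi> (systematic_scan n q) = ?F [1..<n + 1] (bind_pmf ?\<pi> return_pmf)"
    unfolding systematic_scan_def by (rule bind)
  ultimately show ?thesis by (simp only: bind_return_pmf')
qed

end

theory Submission
  imports Defs "HOL-Real_Asymp.Real_Asymp"
begin

text \<open>
  After \<open>T\<close> scans the chain still remembers its start. The reason is a stationary correlation that
  can be computed exactly. Run the scan from a uniform coloring \<open>X\<^sub>0\<close>. A vertex \<open>c\<close> is untouched until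
  the scan reaches it, and after the vertices \<open>1, \<dots>, c - 1\<close> have been updated the current coloring is
  again uniform; hence the pair of \<open>X\<^sub>0 c\<close> and the restriction of \<open>X\<^sub>1\<close> to the vertices below \<open>c\<close> is
  distributed as in a single uniform coloring. Since \<open>X\<^sub>1\<close> up to \<open>m\<close> depends only on \<open>X\<^sub>0\<close> up to
  \<open>m + 1\<close>, this iterates: the pair \<open>(X\<^sub>0 (v + T), X\<^sub>T v)\<close> has the law of \<open>(\<sigma> (v + T), \<sigma> v)\<close> for a
  uniform \<open>\<sigma>\<close> (\<open>start_end_correlation\<close>). Along the path the colors of a uniform coloring form a random
  walk on the complete graph with \<open>q\<close> vertices, so for even \<open>T\<close> the two colors agree with probability
  \<open>1 / q + \<kappa>\<close>, where \<open>\<kappa> = (1 - 1 / q) / (q - 1) ^ T\<close> (\<open>two_point_prob\<close>, \<open>stationary_match_prob\<close>).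

  To amplify this small bias, take \<open>m\<close> vertices \<open>v\<^sub>j\<close> at distance \<open>2 l + 1\<close> and a start \<open>x\<close> for which the
  expected number of \<open>j\<close> with \<open>X\<^sub>T v\<^sub>j = x (v\<^sub>j + T)\<close> is at least the average value \<open>m (1 / q + \<kappa>)\<close>.
  Under the uniform distribution the expected number is only \<open>m / q\<close>. Chebyshev's inequality separates
  the two cases if \<open>m \<kappa>\<^sup>2\<close> is large and the events are nearly uncorrelated
  (\<open>count_concentration\<close>, \<open>scan_distinguished\<close>).

  For a uniform coloring, correlations decay like \<open>(q - 1) ^ (- l)\<close>. For the chain started at \<open>x\<close>,
  where within a single scan information can travel right arbitrarily far, call a vertex frozen if all
  its \<open>T\<close> proposals equal its initial color. This has probability \<open>q ^ (- T)\<close>, independently for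
  different vertices, and a frozen vertex never changes, so that it separates the two sides. With
  \<open>l\<close> much larger than \<open>q ^ T\<close>, each \<open>v\<^sub>j\<close> is very likely to lie between two frozen vertices of its
  own window, and then \<open>X\<^sub>T v\<^sub>j\<close> is determined by the proposals in this window
  (\<open>run_between_frozen\<close>, \<open>scan_covariance\<close>).

  If \<open>T\<close> is at most \<open>log n / 6\<close>, to base \<open>q - 1\<close>, then \<open>q ^ T\<close> and \<open>1 / \<kappa>\<^sup>2\<close> are \<open>O(n\<^bsup>1/3\<^esup>)\<close>, and
  \<open>l \<approx> \<surd>n\<close>, \<open>m \<approx> \<surd>n / 2\<close> meets both requirements.
\<close>

section \<open>Total variation distance and mixing times\<close>

lemma expectation_bind_pmf:
  fixes h :: "'b \<Rightarrow> real"
  assumes "finite (set_pmf p)" "\<And>x. x \<in> set_pmf p \<Longrightarrow> finite (set_pmf (K x))"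
  shows "measure_pmf.expectation (bind_pmf p K) h =
    measure_pmf.expectation p (\<lambda>x. measure_pmf.expectation (K x) h)"
  using assms
  by (simp add: pmf_expectation_bind[of "set_pmf p"] integral_measure_pmf[of "set_pmf p"])

lemma expectation_in_unit_interval:
  fixes f :: "'a \<Rightarrow> real"
  assumes "finite (set_pmf p)" "\<And>x. 0 \<le> f x \<and> f x \<le> 1"
  shows "0 \<le> measure_pmf.expectation p f \<and> measure_pmf.expectation p f \<le> 1"
  using assms
  by (auto intro!: integral_nonneg_AE measure_pmf.integral_le_const integrable_measure_pmf_finite)

lemma expectation_diff_le_dTV:
  fixes f :: "'a \<Rightarrow> real"
  assumes "finite S" "set_pmf p \<subseteq> S" "set_pmf r \<subseteq> S" and f: "\<And>x. 0 \<le> f x \<and> f x \<le> 1"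
  shows "measure_pmf.expectation p f - measure_pmf.expectation r f \<le> dTV S p r"
proof -
  have "measure_pmf.expectation p f - measure_pmf.expectation r f =
      (\<Sum>x\<in>S. (pmf p x - pmf r x) * f x)"
    using assms(1-3) by (subst (1 2) integral_measure_pmf[of S]) (auto simp: sum_subtractf algebra_simps)
  \<comment> \<open>Both masses are \<open>1\<close>, so \<open>f\<close> may be centred; this gives the factor \<open>1/2\<close> of the distance.\<close>
  also have "\<dots> = (\<Sum>x\<in>S. (pmf p x - pmf r x) * (f x - 1/2))"
    using assms(1-3) by (simp add: algebra_simps sum.distrib sum_subtractf sum_pmf_eq_1
      flip: sum_divide_distrib)
  also have "\<dots> \<le> (\<Sum>x\<in>S. \<bar>pmf p x - pmf r x\<bar> * (1/2))"
  proof (intro sum_mono)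
    fix x
    have "(pmf p x - pmf r x) * (f x - 1/2) \<le> \<bar>pmf p x - pmf r x\<bar> * \<bar>f x - 1/2\<bar>"
      by (metis abs_ge_self abs_mult)
    also have "\<dots> \<le> \<bar>pmf p x - pmf r x\<bar> * (1/2)"
      using f[of x] by (intro mult_left_mono) (auto simp: abs_if)
    finally show "(pmf p x - pmf r x) * (f x - 1/2) \<le> \<bar>pmf p x - pmf r x\<bar> * (1/2)" .
  qed
  finally show ?thesis by (simp add: dTV_def flip: sum_divide_distrib)
qed

lemma kernel_power_closed:
  assumes "\<And>x. x \<in> S \<Longrightarrow> set_pmf (K x) \<subseteq> S" "x \<in> S"
  shows "set_pmf (kernel_power K t x) \<subseteq> S"
  using assms by (induction t) (auto simp: set_bind_pmf)

lemma kernel_power_add: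
  "kernel_power K (s + t) x = bind_pmf (kernel_power K s x) (kernel_power K t)"
  by (induction t) (simp_all add: bind_return_pmf' bind_assoc_pmf)

lemma kernel_power_stationary:
  assumes "bind_pmf \<pi> K = \<pi>"
  shows "bind_pmf \<pi> (kernel_power K t) = \<pi>"
proof (induction t)
  case (Suc t)
  have "kernel_power K (Suc t) = (\<lambda>x. bind_pmf (kernel_power K t x) K)" by auto
  then have "bind_pmf \<pi> (kernel_power K (Suc t)) = bind_pmf (bind_pmf \<pi> (kernel_power K t)) K"
    by (simp only: bind_assoc_pmf)
  then show ?case by (simp only: Suc assms)
qed (simp add: bind_return_pmf')

text \<open>Running the chain further only contracts the distance to stationarity, so a test function
  that separates the chain from \<open>\<pi>\<close> at a late time bounds the distance at every earlier time.\<close>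

lemma later_test_le_dTV:
  fixes f :: "'a \<Rightarrow> real"
  assumes "finite S" and closed: "\<And>x. x \<in> S \<Longrightarrow> set_pmf (K x) \<subseteq> S"
    and \<pi>: "set_pmf \<pi> \<subseteq> S" "bind_pmf \<pi> K = \<pi>" and "x \<in> S"
    and f: "\<And>x. 0 \<le> f x \<and> f x \<le> 1" and "t \<le> T"
  shows "measure_pmf.expectation (kernel_power K T x) f - measure_pmf.expectation \<pi> f
    \<le> dTV S (kernel_power K t x) \<pi>"
proof -
  note supp = kernel_power_closed[of S K, OF closed]
  have fin: "finite (set_pmf (kernel_power K s y))" if "y \<in> S" for s y
    using supp[OF _ that] \<open>finite S\<close> finite_subset by blast
  \<comment> \<open>Outside \<open>S\<close> the kernel is unconstrained, hence the case distinction.\<close>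
  define g where "g = (\<lambda>y. if y \<in> S then measure_pmf.expectation (kernel_power K (T - t) y) f else 0)"
  have bind: "measure_pmf.expectation (bind_pmf r (kernel_power K (T - t))) f =
      measure_pmf.expectation r g" if "set_pmf r \<subseteq> S" for r
  proof -
    have "finite (set_pmf r)" using that \<open>finite S\<close> finite_subset by blast
    then have "measure_pmf.expectation (bind_pmf r (kernel_power K (T - t))) f =
      measure_pmf.expectation r (\<lambda>y. measure_pmf.expectation (kernel_power K (T - t) y) f)"
      using that fin by (subst expectation_bind_pmf) auto
    also have "\<dots> = measure_pmf.expectation r g"
      using that by (intro integral_cong_AE AE_pmfI) (auto simp: g_def)
    finally show ?thesis .
  qed
  have "0 \<le> g y \<and> g y \<le> 1" for y
    using expectation_in_unit_interval[OF fin f] by (auto simp: g_def)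
  then have "measure_pmf.expectation (kernel_power K t x) g - measure_pmf.expectation \<pi> g
      \<le> dTV S (kernel_power K t x) \<pi>"
    using assms supp by (intro expectation_diff_le_dTV) auto
  moreover have "measure_pmf.expectation (kernel_power K T x) f =
      measure_pmf.expectation (kernel_power K t x) g"
    using bind[OF supp[OF _ \<open>x \<in> S\<close>, of t]] \<open>t \<le> T\<close> by (simp flip: kernel_power_add)
  moreover have "measure_pmf.expectation \<pi> f = measure_pmf.expectation \<pi> g"
    using bind[OF \<pi>(1)] kernel_power_stationary[OF \<pi>(2)] by simp
  ultimately show ?thesis by simp
qed

lemma Mix_ge:
  assumes "finite S" "x \<in> S" and b: "\<And>t. t > 0 \<Longrightarrow> dTV S (kernel_power K t x) \<pi> \<le> \<epsilon> \<Longrightarrow> b \<le> real t"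
  shows "ereal b \<le> ereal_of_enat (Mix S K \<pi> \<epsilon>)"
proof -
  define A where "A = {enat t | t. t > 0 \<and> dTV S (kernel_power K t x) \<pi> \<le> \<epsilon>}"
  have "ereal b \<le> ereal_of_enat (Inf A)"
  proof (cases "A = {}")
    case False
    then have "Inf A \<in> A" by (metis LeastI Inf_enat_def all_not_in_conv)
    then show ?thesis using b by (auto simp: A_def)
  qed (simp add: Inf_enat_def)
  moreover have "Inf A \<le> Mix S K \<pi> \<epsilon>"
    using assms(1,2) unfolding Mix_def A_def by (intro Max_ge) (auto simp: Mix_from_def)
  ultimately show ?thesis using ereal_of_enat_le_iff order_trans by blast
qed

section \<open>Counting weakly correlated events\<close>

text \<open>Chebyshev's inequality: with pairwise covariances at most \<open>\<eta>\<close>, the number of occurring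
  events has variance at most \<open>m + m\<^sup>2 \<eta>\<close>.\<close>

lemma count_concentration:
  fixes p :: "'a pmf" and E :: "'i \<Rightarrow> 'a set" and a \<eta> :: real
  assumes fin: "finite (set_pmf p)" "finite J" and "a > 0" "\<eta> \<ge> 0"
    and cov: "\<And>i j. i \<in> J \<Longrightarrow> j \<in> J \<Longrightarrow> i \<noteq> j \<Longrightarrow>
      measure_pmf.prob p (E i \<inter> E j) - measure_pmf.prob p (E i) * measure_pmf.prob p (E j) \<le> \<eta>"
  shows "measure_pmf.prob p {y. \<bar>(\<Sum>j\<in>J. indicator (E j) y) - (\<Sum>j\<in>J. measure_pmf.prob p (E j))\<bar> \<ge> a}
    \<le> (card J + (card J)\<^sup>2 * \<eta>) / a\<^sup>2"
proof -
  let ?C = "\<lambda>y. \<Sum>j\<in>J. indicator (E j) y :: real"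
  note int = integrable_measure_pmf_finite[OF fin(1)]
  have mean: "measure_pmf.expectation p ?C = (\<Sum>j\<in>J. measure_pmf.prob p (E j))"
    by (simp add: int)
  have "measure_pmf.variance p ?C = measure_pmf.expectation p (\<lambda>y. (?C y)\<^sup>2) - (measure_pmf.expectation p ?C)\<^sup>2"
    by (rule measure_pmf.variance_eq) (auto intro: int)
  also have "measure_pmf.expectation p (\<lambda>y. (?C y)\<^sup>2) = (\<Sum>i\<in>J. \<Sum>j\<in>J. measure_pmf.prob p (E i \<inter> E j))"
    by (simp add: power2_eq_square sum_product int flip: indicator_inter_arith)
  also have "(measure_pmf.expectation p ?C)\<^sup>2 =
      (\<Sum>i\<in>J. \<Sum>j\<in>J. measure_pmf.prob p (E i) * measure_pmf.prob p (E j))"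
    unfolding mean by (simp add: power2_eq_square sum_product)
  also have "(\<Sum>i\<in>J. \<Sum>j\<in>J. measure_pmf.prob p (E i \<inter> E j)) - \<dots> =
      (\<Sum>i\<in>J. \<Sum>j\<in>J. measure_pmf.prob p (E i \<inter> E j) - measure_pmf.prob p (E i) * measure_pmf.prob p (E j))"
    by (simp add: sum_subtractf)
  also have "\<dots> \<le> (\<Sum>i\<in>J. \<Sum>j\<in>J. (if j = i then 1 else 0) + \<eta>)"
  proof (intro sum_mono)
    fix i j assume "i \<in> J" "j \<in> J"
    have "measure_pmf.prob p (E i) - measure_pmf.prob p (E i) * measure_pmf.prob p (E i) \<le> 1 + \<eta>"
      using measure_pmf.prob_le_1[of p "E i"] \<open>\<eta> \<ge> 0\<close>
      by (smt (verit) mult_nonneg_nonneg measure_nonneg)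
    then show "measure_pmf.prob p (E i \<inter> E j) - measure_pmf.prob p (E i) * measure_pmf.prob p (E j)
        \<le> (if j = i then 1 else 0) + \<eta>"
      using cov[of i j] \<open>i \<in> J\<close> \<open>j \<in> J\<close> by auto
  qed
  also have "\<dots> = card J + (card J)\<^sup>2 * \<eta>"
    using fin by (simp add: sum.distrib power2_eq_square algebra_simps)
  finally have var: "measure_pmf.variance p ?C \<le> card J + (card J)\<^sup>2 * \<eta>" .
  have "measure_pmf.prob p {y. \<bar>?C y - measure_pmf.expectation p ?C\<bar> \<ge> a}
      \<le> measure_pmf.variance p ?C / a\<^sup>2"
    using measure_pmf.Chebyshev_inequality[OF _ int \<open>a > 0\<close>, of ?C] by simp
  also have "\<dots> \<le> (card J + (card J)\<^sup>2 * \<eta>) / a\<^sup>2"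
    using var by (intro divide_right_mono) auto
  finally show ?thesis unfolding mean .
qed

section \<open>Two-point correlations of a uniform proper coloring\<close>

lemma proper_colorings_less:
  assumes "\<sigma> \<in> proper_colorings n q" "1 \<le> v" "v \<le> n"
  shows "\<sigma> v < q"
  using assms by (auto simp: proper_colorings_def colorings_def PiE_iff)

lemma proper_colorings_adjacent:
  assumes "\<sigma> \<in> proper_colorings n q" "1 \<le> v" "v < n"
  shows "\<sigma> v \<noteq> \<sigma> (Suc v)"
  using assms by (auto simp: proper_colorings_def path_edges_iff)

text \<open>Exchanging two colors on all vertices \<open>\<ge> w\<close> keeps a coloring proper as long as neither
  color occurs at \<open>w - 1\<close>. These symmetries determine all two-point probabilities.\<close>

definition swap_tail :: "nat \<Rightarrow> nat \<Rightarrow> nat \<Rightarrow> nat \<Rightarrow> (nat \<Rightarrow> nat) \<Rightarrow> nat \<Rightarrow> nat" where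
  "swap_tail n w b c \<sigma> = (\<lambda>i. if w \<le> i \<and> i \<le> n then Transposition.transpose b c (\<sigma> i) else \<sigma> i)"

lemma swap_tail_proper:
  assumes "\<sigma> \<in> proper_colorings n q" "b < q" "c < q" "1 \<le> w" "w = 1 \<or> \<sigma> (w - 1) \<notin> {b, c}"
  shows "swap_tail n w b c \<sigma> \<in> proper_colorings n q"
proof -
  have col: "swap_tail n w b c \<sigma> \<in> colorings n q"
    using assms unfolding proper_colorings_def colorings_def swap_tail_def
    by (auto simp: PiE_iff extensional_def Transposition.transpose_def)
  have fix_left: "Transposition.transpose b c (\<sigma> (w - 1)) = \<sigma> (w - 1)" if "w \<noteq> 1"
    using assms(5) that by (auto simp: Transposition.transpose_def)
  have "swap_tail n w b c \<sigma> v \<noteq> swap_tail n w b c \<sigma> (v + 1)" if "1 \<le> v" "v + 1 \<le> n" for v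
  proof -
    have ne: "Transposition.transpose b c (\<sigma> v) \<noteq> Transposition.transpose b c (\<sigma> (v + 1))"
      using proper_colorings_adjacent[OF assms(1), of v] that by (auto dest: transpose_eq_imp_eq)
    show ?thesis
    proof (cases "v + 1 = w")
      case True
      then show ?thesis using ne fix_left that by (auto simp: swap_tail_def)
    next
      case False
      then show ?thesis using ne that proper_colorings_adjacent[OF assms(1), of v]
        by (auto simp: swap_tail_def)
    qed
  qed
  then have "swap_tail n w b c \<sigma> u \<noteq> swap_tail n w b c \<sigma> v" if "{u, v} \<in> path_edges n" for u v
    using that by (fastforce simp: path_edges_iff)
  with col show ?thesis unfolding proper_colorings_def by blast
qed

lemma swap_tail_involution: "swap_tail n w b c (swap_tail n w b c \<sigma>) = \<sigma>"
  by (auto simp: swap_tail_def)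

lemma card_swap_tail:
  assumes "b < q" "c < q" "1 \<le> w" "w \<le> i" "i \<le> n"
    and P: "\<And>\<sigma>. P (swap_tail n w b c \<sigma>) \<longleftrightarrow> P \<sigma>"
      "\<And>\<sigma>. P \<sigma> \<Longrightarrow> w = 1 \<or> \<sigma> (w - 1) \<notin> {b, c}"
  shows "card {\<sigma> \<in> proper_colorings n q. P \<sigma> \<and> \<sigma> i = b} =
    card {\<sigma> \<in> proper_colorings n q. P \<sigma> \<and> \<sigma> i = c}"
proof (rule bij_betw_same_card[of "swap_tail n w b c"], rule bij_betw_byWitness[where f' = "swap_tail n w b c"])
  have i: "swap_tail n w b c \<sigma> i = Transposition.transpose b c (\<sigma> i)" for \<sigma>
    using assms by (simp add: swap_tail_def)
  have closed: "swap_tail n w b c \<sigma> \<in> proper_colorings n q" if "\<sigma> \<in> proper_colorings n q" "P \<sigma>" for \<sigma>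
    using swap_tail_proper[OF that(1) assms(1,2,3) P(2)[OF that(2)]] .
  show "swap_tail n w b c ` {\<sigma> \<in> proper_colorings n q. P \<sigma> \<and> \<sigma> i = b} \<subseteq> {\<sigma> \<in> proper_colorings n q. P \<sigma> \<and> \<sigma> i = c}"
    by (intro image_subsetI) (simp add: i P(1) closed)
  show "swap_tail n w b c ` {\<sigma> \<in> proper_colorings n q. P \<sigma> \<and> \<sigma> i = c} \<subseteq> {\<sigma> \<in> proper_colorings n q. P \<sigma> \<and> \<sigma> i = b}"
    by (intro image_subsetI) (simp add: i P(1) closed)
qed (auto simp: swap_tail_involution)

lemma card_partition_by_color:
  assumes "1 \<le> v" "v \<le> n"
  shows "card {\<sigma> \<in> proper_colorings n q. P \<sigma>} = (\<Sum>b<q. card {\<sigma> \<in> proper_colorings n q. P \<sigma> \<and> \<sigma> v = b})"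
proof -
  have "{\<sigma> \<in> proper_colorings n q. P \<sigma>} = (\<Union>b<q. {\<sigma> \<in> proper_colorings n q. P \<sigma> \<and> \<sigma> v = b})"
    using proper_colorings_less assms by blast
  also have "card \<dots> = (\<Sum>b<q. card {\<sigma> \<in> proper_colorings n q. P \<sigma> \<and> \<sigma> v = b})"
    using finite_proper_colorings[of n q] by (intro card_UN_disjoint) auto
  finally show ?thesis .
qed

abbreviation uniform_coloring :: "nat \<Rightarrow> nat \<Rightarrow> (nat \<Rightarrow> nat) pmf" where
  "uniform_coloring n q \<equiv> pmf_of_set (proper_colorings n q)"

lemma prob_uniform_coloring:
  assumes "q \<ge> 2"
  shows "measure_pmf.prob (uniform_coloring n q) {\<sigma>. P \<sigma>} =
    card {\<sigma> \<in> proper_colorings n q. P \<sigma>} / card (proper_colorings n q)"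
  using finite_proper_colorings proper_colorings_nonempty[OF assms]
  by (simp add: measure_pmf_of_set Int_def)

lemma one_point_prob:
  assumes "q \<ge> 2" "1 \<le> v" "v \<le> n" "b < q"
  shows "measure_pmf.prob (uniform_coloring n q) {\<sigma>. \<sigma> v = b} = 1 / q"
proof -
  let ?N = "\<lambda>c. card {\<sigma> \<in> proper_colorings n q. True \<and> \<sigma> v = c}"
  have "?N c = ?N b" if "c < q" for c
    by (rule card_swap_tail[where w = 1]) (use assms that in auto)
  then have "(\<Sum>c<q. ?N c) = q * ?N b" by simp
  then have *: "card (proper_colorings n q) = q * card {\<sigma> \<in> proper_colorings n q. \<sigma> v = b}"
    using card_partition_by_color[OF assms(2,3), of q "\<lambda>_. True"]
    by (simp only: simp_thms Collect_mem_eq)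
  have "card (proper_colorings n q) > 0"
    using finite_proper_colorings proper_colorings_nonempty[OF assms(1)] by (simp add: card_gt_0_iff)
  then show ?thesis unfolding prob_uniform_coloring[OF assms(1)] using *
    by (auto simp: field_simps simp flip: of_nat_mult)
qed

lemma card_repeated_color:
  assumes "1 \<le> v" "v < n" "\<And>\<sigma>. P \<sigma> \<Longrightarrow> \<sigma> v = \<sigma> (Suc v)"
  shows "card {\<sigma> \<in> proper_colorings n q. P \<sigma>} = 0"
proof -
  have "\<not> P \<sigma>" if "\<sigma> \<in> proper_colorings n q" for \<sigma>
    using proper_colorings_adjacent[OF that assms(1,2)] assms(3) by blast
  then have "{\<sigma> \<in> proper_colorings n q. P \<sigma>} = {}" by blast
  then show ?thesis by (simp only: card.empty)
qed

text \<open>Given the colors up to \<open>v\<close>, the color at \<open>v + 1\<close> is uniform on the \<open>q - 1\<close> colors other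
  than that of \<open>v\<close>: the tail swap exchanges any two of them.\<close>

lemma card_next_color:
  assumes "q \<ge> 2" "1 \<le> u" "u \<le> v" "v < n" "b < q"
  shows "(q - 1) * card {\<sigma> \<in> proper_colorings n q. \<sigma> u = a \<and> \<sigma> (Suc v) = b} +
     card {\<sigma> \<in> proper_colorings n q. \<sigma> u = a \<and> \<sigma> v = b} = card {\<sigma> \<in> proper_colorings n q. \<sigma> u = a}"
proof -
  let ?N = "\<lambda>P. card {\<sigma> \<in> proper_colorings n q. P \<sigma>}"
  have step: "(q - 1) * ?N (\<lambda>\<sigma>. (\<sigma> u = a \<and> \<sigma> v = e) \<and> \<sigma> (Suc v) = b) = ?N (\<lambda>\<sigma>. \<sigma> u = a \<and> \<sigma> v = e)"
    if "e < q" "e \<noteq> b" for e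
  proof -
    have "?N (\<lambda>\<sigma>. \<sigma> u = a \<and> \<sigma> v = e) = (\<Sum>c<q. ?N (\<lambda>\<sigma>. (\<sigma> u = a \<and> \<sigma> v = e) \<and> \<sigma> (Suc v) = c))"
      using assms by (intro card_partition_by_color) auto
    also have "\<dots> = (\<Sum>c\<in>{..<q} - {e}. ?N (\<lambda>\<sigma>. (\<sigma> u = a \<and> \<sigma> v = e) \<and> \<sigma> (Suc v) = c))"
    proof (intro sum.mono_neutral_right ballI)
      fix c assume "c \<in> {..<q} - ({..<q} - {e})"
      then have "c = e" using that by auto
      then show "?N (\<lambda>\<sigma>. (\<sigma> u = a \<and> \<sigma> v = e) \<and> \<sigma> (Suc v) = c) = 0"
        using assms by (intro card_repeated_color) auto
    qed auto
    also have "\<dots> = (\<Sum>c\<in>{..<q} - {e}. ?N (\<lambda>\<sigma>. (\<sigma> u = a \<and> \<sigma> v = e) \<and> \<sigma> (Suc v) = b))"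
      using assms that by (intro sum.cong card_swap_tail[where w = "Suc v"]) (auto simp: swap_tail_def)
    also have "\<dots> = (q - 1) * ?N (\<lambda>\<sigma>. (\<sigma> u = a \<and> \<sigma> v = e) \<and> \<sigma> (Suc v) = b)"
      using that by simp
    finally show ?thesis by simp
  qed
  have "?N (\<lambda>\<sigma>. \<sigma> u = a \<and> \<sigma> (Suc v) = b) = (\<Sum>e<q. ?N (\<lambda>\<sigma>. (\<sigma> u = a \<and> \<sigma> (Suc v) = b) \<and> \<sigma> v = e))"
    using assms by (intro card_partition_by_color) auto
  also have "\<dots> = (\<Sum>e\<in>{..<q} - {b}. ?N (\<lambda>\<sigma>. (\<sigma> u = a \<and> \<sigma> (Suc v) = b) \<and> \<sigma> v = e))"
  proof (intro sum.mono_neutral_right ballI)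
    fix c assume "c \<in> {..<q} - ({..<q} - {b})"
    then have "c = b" using assms by auto
    then show "?N (\<lambda>\<sigma>. (\<sigma> u = a \<and> \<sigma> (Suc v) = b) \<and> \<sigma> v = c) = 0"
        using assms by (intro card_repeated_color) auto
  qed auto
  also have "\<dots> = (\<Sum>e\<in>{..<q} - {b}. ?N (\<lambda>\<sigma>. (\<sigma> u = a \<and> \<sigma> v = e) \<and> \<sigma> (Suc v) = b))"
    by (intro sum.cong refl arg_cong[of _ _ card]) auto
  finally have "(q - 1) * ?N (\<lambda>\<sigma>. \<sigma> u = a \<and> \<sigma> (Suc v) = b) =
      (\<Sum>e\<in>{..<q} - {b}. (q - 1) * ?N (\<lambda>\<sigma>. (\<sigma> u = a \<and> \<sigma> v = e) \<and> \<sigma> (Suc v) = b))"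
    by (simp only: sum_distrib_left)
  also have "\<dots> = (\<Sum>e\<in>{..<q} - {b}. ?N (\<lambda>\<sigma>. \<sigma> u = a \<and> \<sigma> v = e))"
    by (intro sum.cong refl step) auto
  finally have "(q - 1) * ?N (\<lambda>\<sigma>. \<sigma> u = a \<and> \<sigma> (Suc v) = b) + ?N (\<lambda>\<sigma>. \<sigma> u = a \<and> \<sigma> v = b) =
     (\<Sum>e<q. ?N (\<lambda>\<sigma>. \<sigma> u = a \<and> \<sigma> v = e))"
    using assms sum.remove[of "{..<q}" b "\<lambda>e. ?N (\<lambda>\<sigma>. \<sigma> u = a \<and> \<sigma> v = e)"] by simp
  also have "\<dots> = ?N (\<lambda>\<sigma>. \<sigma> u = a)"
    using assms by (intro card_partition_by_color[symmetric]) auto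
  finally show ?thesis .
qed

text \<open>Along the path the colors perform a random walk on the complete graph; its transition matrix has
  the eigenvalues \<open>1\<close> and \<open>- 1 / (q - 1)\<close>.\<close>

lemma two_point_prob:
  assumes "q \<ge> 2" "1 \<le> u" "u + k \<le> n" "a < q" "b < q"
  shows "measure_pmf.prob (uniform_coloring n q) {\<sigma>. \<sigma> u = a \<and> \<sigma> (u + k) = b} =
    1 / (real q)\<^sup>2 + (- 1 / (real q - 1)) ^ k * ((if a = b then 1 / q else 0) - 1 / (real q)\<^sup>2)"
  using assms(3,5)
proof (induction k)
  case 0
  show ?case
  proof (cases "a = b")
    case True
    then show ?thesis using one_point_prob[of q u n a] assms 0 by simp
  next
    case False
    then have empty: "{\<sigma>. \<sigma> u = a \<and> \<sigma> (u + 0) = b} = {}" by auto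
    show ?thesis unfolding empty using False by simp
  qed
next
  case (Suc k)
  let ?p = "\<lambda>P. measure_pmf.prob (uniform_coloring n q) {\<sigma>. P \<sigma>}"
  have "real ((q - 1) * card {\<sigma> \<in> proper_colorings n q. \<sigma> u = a \<and> \<sigma> (Suc (u + k)) = b} +
     card {\<sigma> \<in> proper_colorings n q. \<sigma> u = a \<and> \<sigma> (u + k) = b}) = real (card {\<sigma> \<in> proper_colorings n q. \<sigma> u = a})"
    using card_next_color[of q u "u + k" n b a] assms Suc.prems by (simp only: of_nat_eq_iff)
  then have "(real q - 1) * ?p (\<lambda>\<sigma>. \<sigma> u = a \<and> \<sigma> (u + Suc k) = b) + ?p (\<lambda>\<sigma>. \<sigma> u = a \<and> \<sigma> (u + k) = b) = 1 / q"
    using one_point_prob[of q u n a] assms Suc.prems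
    by (simp add: prob_uniform_coloring of_nat_diff add_divide_distrib[symmetric])
  then have "?p (\<lambda>\<sigma>. \<sigma> u = a \<and> \<sigma> (u + Suc k) = b) = (1 / q - ?p (\<lambda>\<sigma>. \<sigma> u = a \<and> \<sigma> (u + k) = b)) / (real q - 1)"
    using assms(1) by (simp add: field_simps)
  also have "\<dots> = (1 / q - (1 / (real q)\<^sup>2 + (- 1 / (real q - 1)) ^ k * ((if a = b then 1 / q else 0) - 1 / (real q)\<^sup>2))) / (real q - 1)"
    using Suc by simp
  also have "\<dots> = (1 / q - 1 / (real q)\<^sup>2) / (real q - 1)
      + (- 1 / (real q - 1)) ^ Suc k * ((if a = b then 1 / q else 0) - 1 / (real q)\<^sup>2)"
    by (simp add: diff_divide_distrib add_divide_distrib)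
  also have "(1 / q - 1 / (real q)\<^sup>2) / (real q - 1) = 1 / (real q)\<^sup>2"
    using assms(1) by (simp add: field_simps power2_eq_square)
  finally show ?case .
qed

section \<open>The scan driven by independent proposals\<close>

definition recolor :: "nat \<Rightarrow> nat \<Rightarrow> nat \<Rightarrow> (nat \<Rightarrow> nat) \<Rightarrow> nat \<Rightarrow> nat" where
  "recolor n v c \<sigma> = (if \<forall>w. {v, w} \<in> path_edges n \<longrightarrow> \<sigma> w \<noteq> c then \<sigma>(v := c) else \<sigma>)"

text \<open>The number \<open>k\<close> counts single-vertex updates, so that scan \<open>s\<close> (counting from \<open>0\<close>) consists of
  the updates \<open>s n, \<dots>, s n + n - 1\<close>. The parameter \<open>W\<close> suppresses all updates outside \<open>W\<close>; it
  serves to compare the chain with its restriction to a window.\<close>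

definition scanned_vertex :: "nat \<Rightarrow> nat \<Rightarrow> nat" where
  "scanned_vertex n k = k mod n + 1"

primrec run :: "nat \<Rightarrow> nat set \<Rightarrow> (nat \<Rightarrow> nat) \<Rightarrow> (nat \<Rightarrow> nat) \<Rightarrow> nat \<Rightarrow> nat \<Rightarrow> nat" where
  "run n W x U 0 = x"
| "run n W x U (Suc k) = (if scanned_vertex n k \<in> W then recolor n (scanned_vertex n k) (U k) (run n W x U k)
     else run n W x U k)"

definition proposals :: "nat \<Rightarrow> nat \<Rightarrow> (nat \<Rightarrow> nat) pmf" where
  "proposals q k = Pi_pmf {..<k} 0 (\<lambda>_. pmf_of_set {0..<q})"

lemma finite_set_proposals: "q > 0 \<Longrightarrow> finite (set_pmf (proposals q k))"
  by (auto simp: proposals_def set_Pi_pmf set_pmf_of_set intro!: finite_PiE_dflt)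

lemma recolor_cong:
  assumes "\<sigma> w = \<tau> w"
    and "\<And>i. w = v \<Longrightarrow> 1 \<le> i \<Longrightarrow> i \<le> n \<Longrightarrow> i + 1 = v \<or> i = v + 1 \<Longrightarrow> \<sigma> i = \<tau> i"
  shows "recolor n v c \<sigma> w = recolor n v c \<tau> w"
proof (cases "w = v")
  case True
  then have "\<sigma> i = \<tau> i" if "{v, i} \<in> path_edges n" for i
    using that assms(2)[of i] by (auto simp: path_edges_iff)
  then have "(\<forall>i. {v, i} \<in> path_edges n \<longrightarrow> \<sigma> i \<noteq> c) \<longleftrightarrow> (\<forall>i. {v, i} \<in> path_edges n \<longrightarrow> \<tau> i \<noteq> c)"
    by auto
  then show ?thesis using True assms(1) by (auto simp: recolor_def)
qed (use assms(1) in \<open>simp add: recolor_def\<close>)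

lemma recolor_same: "\<sigma> v = c \<Longrightarrow> recolor n v c \<sigma> = \<sigma>"
  by (auto simp: recolor_def)

lemma recolor_other: "w \<noteq> v \<Longrightarrow> recolor n v c \<sigma> w = \<sigma> w"
  by (simp add: recolor_def)

lemma run_proposals_cong:
  assumes "\<And>i. i < k \<Longrightarrow> scanned_vertex n i \<in> W \<Longrightarrow> U i = V i"
  shows "run n W x U k = run n W x V k"
  using assms by (induction k) auto

lemma run_pmf_Suc:
  "map_pmf (\<lambda>U. run n UNIV x U (Suc k)) (proposals q (Suc k)) =
     bind_pmf (map_pmf (\<lambda>U. run n UNIV x U k) (proposals q k)) (metropolis n q (scanned_vertex n k))"
proof -
  have run: "run n UNIV x (U(k := c)) (Suc k) = recolor n (scanned_vertex n k) c (run n UNIV x U k)" for U c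
    using run_proposals_cong[of k n UNIV "U(k := c)" U x] by simp
  have "map_pmf (\<lambda>U. run n UNIV x U (Suc k)) (proposals q (Suc k)) =
    bind_pmf (pmf_of_set {0..<q}) (\<lambda>c. bind_pmf (proposals q k)
      (\<lambda>U. return_pmf (recolor n (scanned_vertex n k) c (run n UNIV x U k))))"
    unfolding proposals_def lessThan_Suc
    by (simp add: Pi_pmf_insert' map_bind_pmf run del: run.simps)
  also have "\<dots> = bind_pmf (proposals q k) (\<lambda>U. bind_pmf (pmf_of_set {0..<q})
      (\<lambda>c. return_pmf (recolor n (scanned_vertex n k) c (run n UNIV x U k))))"
    by (rule bind_commute_pmf)
  also have "\<dots> = bind_pmf (map_pmf (\<lambda>U. run n UNIV x U k) (proposals q k)) (metropolis n q (scanned_vertex n k))"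
    by (simp add: bind_map_pmf metropolis_def recolor_def flip: map_pmf_def)
  finally show ?thesis .
qed

lemma fold_metropolis_bind:
  "bind_pmf r (\<lambda>x. fold (\<lambda>v p. bind_pmf p (metropolis n q v)) vs (f x)) =
    fold (\<lambda>v p. bind_pmf p (metropolis n q v)) vs (bind_pmf r f)"
  by (induction vs arbitrary: f) (simp_all add: bind_assoc_pmf)

lemma kernel_power_eq_run:
  "kernel_power (systematic_scan n q) t x = map_pmf (\<lambda>U. run n UNIV x U (t * n)) (proposals q (t * n))"
proof (induction t)
  case 0
  show ?case by (simp add: proposals_def)
next
  case (Suc t)
  let ?law = "\<lambda>k. map_pmf (\<lambda>U. run n UNIV x U k) (proposals q k)"
  have partial_scan: "fold (\<lambda>v p. bind_pmf p (metropolis n q v)) [1..<i + 1] (?law (t * n)) = ?law (t * n + i)"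
    if "i \<le> n" for i
    using that
  proof (induction i)
    case (Suc i)
    then have "fold (\<lambda>v p. bind_pmf p (metropolis n q v)) [1..<Suc i + 1] (?law (t * n)) =
        bind_pmf (?law (t * n + i)) (metropolis n q (i + 1))" by simp
    also have "\<dots> = ?law (t * n + Suc i)"
      using run_pmf_Suc[of n x "t * n + i" q] Suc.prems by (simp add: scanned_vertex_def)
    finally show ?case .
  qed simp
  have "kernel_power (systematic_scan n q) (Suc t) x =
      fold (\<lambda>v p. bind_pmf p (metropolis n q v)) [1..<n + 1] (bind_pmf (?law (t * n)) return_pmf)"
    using Suc unfolding kernel_power.simps systematic_scan_def fold_metropolis_bind by simp
  also have "\<dots> = ?law (t * n + n)" using partial_scan[of n] by (simp only: bind_return_pmf' order_refl)
  finally show ?case by (simp add: add.commute)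
qed

lemma systematic_scan_eq_run:
  "systematic_scan n q x = map_pmf (\<lambda>U. run n UNIV x U n) (proposals q n)"
  using kernel_power_eq_run[of n q 1 x] by (simp add: bind_return_pmf)

section \<open>Correlation between start and end of a stationary run\<close>

text \<open>Information travels left by only one vertex per scan: the right neighbor of an updated vertex
  still has its color from the scan before. The color at \<open>m + 1\<close> itself agrees only until the scan
  gets there, hence the case distinction that keeps the induction going.\<close>

lemma run_scan_locality:
  assumes "\<And>i. i \<le> Suc m \<Longrightarrow> x i = y i" "k \<le> n" "w \<le> (if k \<le> m then Suc m else m)"
  shows "run n UNIV x U k w = run n UNIV y U k w"
  using assms(2,3)
proof (induction k arbitrary: w)
  case (Suc k)
  then have sv: "scanned_vertex n k = Suc k" by (simp add: scanned_vertex_def)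
  have IH: "run n UNIV x U k i = run n UNIV y U k i" if "i \<le> (if k \<le> m then Suc m else m)" for i
    using Suc that by auto
  show ?case
    unfolding run.simps sv using Suc.prems
    by (auto split: if_splits intro!: recolor_cong IH)
qed (use assms in auto)

text \<open>A vertex keeps its color while the scan is elsewhere, both before its update (\<open>k < w\<close>) and after
  it (\<open>w \<le> j\<close>).\<close>

lemma run_later_updates:
  assumes "j \<le> k" "k \<le> n" "w \<le> j \<or> k < w"
  shows "run n UNIV x U k w = run n UNIV x U j w"
  using assms(1)
proof (induction k rule: dec_induct)
  case (step i)
  then show ?case using assms by (auto simp: scanned_vertex_def recolor_other)
qed simp

lemma run_stationary:
  assumes "q \<ge> 2" "k \<le> n"
  shows "bind_pmf (uniform_coloring n q) (\<lambda>x. map_pmf (\<lambda>U. run n UNIV x U k) (proposals q k)) = uniform_coloring n q"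
  using assms(2)
proof (induction k)
  case 0
  show ?case by (simp add: proposals_def bind_return_pmf')
next
  case (Suc k)
  have "bind_pmf (uniform_coloring n q) (\<lambda>x. map_pmf (\<lambda>U. run n UNIV x U (Suc k)) (proposals q (Suc k))) =
    bind_pmf (bind_pmf (uniform_coloring n q) (\<lambda>x. map_pmf (\<lambda>U. run n UNIV x U k) (proposals q k)))
      (metropolis n q (scanned_vertex n k))"
    unfolding run_pmf_Suc bind_assoc_pmf ..
  then show ?case
    using Suc metropolis_stationary[OF assms(1), of "scanned_vertex n k" n] by (simp add: scanned_vertex_def)
qed

lemma proposals_restrict:
  assumes "k \<le> N"
  shows "map_pmf (\<lambda>U. run n W x U k) (proposals q N) = map_pmf (\<lambda>U. run n W x U k) (proposals q k)"
proof -
  have "proposals q k = map_pmf (\<lambda>U i. if i \<in> {..<k} then U i else 0) (proposals q N)"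
    unfolding proposals_def using assms by (intro Pi_pmf_subset) auto
  then have "map_pmf (\<lambda>U. run n W x U k) (proposals q k) =
      map_pmf (\<lambda>U. run n W x (\<lambda>i. if i \<in> {..<k} then U i else 0) k) (proposals q N)"
    by (simp add: pmf.map_comp o_def)
  also have "\<dots> = map_pmf (\<lambda>U. run n W x U k) (proposals q N)"
    by (intro map_pmf_cong refl run_proposals_cong) auto
  finally show ?thesis ..
qed

lemma finite_set_kernel_power_scan:
  "q > 0 \<Longrightarrow> finite (set_pmf (kernel_power (systematic_scan n q) t x))"
  by (simp add: kernel_power_eq_run finite_set_proposals)

lemma finite_set_uniform_coloring: "q \<ge> 2 \<Longrightarrow> finite (set_pmf (uniform_coloring n q))"
  by (simp add: set_pmf_of_set proper_colorings_nonempty finite_proper_colorings)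

text \<open>Just before vertex \<open>c\<close> is updated, the coloring is uniform, still carries the old color of \<open>c\<close>, and
  already carries the final colors of the vertices below \<open>c\<close>. So one uniform coloring shows both.\<close>

lemma start_end_correlation_scan:
  fixes a :: "nat \<Rightarrow> real" and g :: "(nat \<Rightarrow> nat) \<Rightarrow> real"
  assumes q: "q \<ge> 2" and "m < c" "c \<le> n" and g: "\<And>y z. (\<And>i. i \<le> m \<Longrightarrow> y i = z i) \<Longrightarrow> g y = g z"
  shows "measure_pmf.expectation (uniform_coloring n q)
      (\<lambda>x. a (x c) * measure_pmf.expectation (systematic_scan n q x) g) =
    measure_pmf.expectation (uniform_coloring n q) (\<lambda>x. a (x c) * g x)"
proof -
  let ?k = "c - 1"
  let ?f = "\<lambda>y. a (y c) * g y"
  have "a (x c) * measure_pmf.expectation (systematic_scan n q x) g =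
      measure_pmf.expectation (map_pmf (\<lambda>U. run n UNIV x U ?k) (proposals q ?k)) ?f" for x
  proof -
    have "g (run n UNIV x U n) = g (run n UNIV x U ?k)" for U
      using assms by (intro g run_later_updates) auto
    moreover have "run n UNIV x U ?k c = x c" for U
      using run_later_updates[of 0 ?k n c x U] assms by simp
    ultimately have "a (x c) * measure_pmf.expectation (systematic_scan n q x) g =
        measure_pmf.expectation (proposals q n) (\<lambda>U. ?f (run n UNIV x U ?k))"
      by (simp add: systematic_scan_eq_run)
    also have "\<dots> = measure_pmf.expectation (map_pmf (\<lambda>U. run n UNIV x U ?k) (proposals q n)) ?f"
      by simp
    also have "map_pmf (\<lambda>U. run n UNIV x U ?k) (proposals q n) =
        map_pmf (\<lambda>U. run n UNIV x U ?k) (proposals q ?k)"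
      using assms by (intro proposals_restrict) auto
    finally show ?thesis .
  qed
  then have "measure_pmf.expectation (uniform_coloring n q)
      (\<lambda>x. a (x c) * measure_pmf.expectation (systematic_scan n q x) g) =
    measure_pmf.expectation (bind_pmf (uniform_coloring n q)
      (\<lambda>x. map_pmf (\<lambda>U. run n UNIV x U ?k) (proposals q ?k))) ?f"
    using q by (subst expectation_bind_pmf) (simp_all add: finite_set_uniform_coloring finite_set_proposals)
  also have "\<dots> = measure_pmf.expectation (uniform_coloring n q) ?f"
    using q assms(3) by (subst run_stationary) auto
  finally show ?thesis .
qed

text \<open>The last of the scans turns an observable of the vertices up to \<open>m\<close> into one of the vertices up to
  \<open>m + 1\<close>. As long as this stays below \<open>c\<close>, the scans can be peeled off one by one.\<close>

lemma start_end_correlation: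
  fixes a :: "nat \<Rightarrow> real" and g :: "(nat \<Rightarrow> nat) \<Rightarrow> real"
  assumes q: "q \<ge> 2" and "m + t \<le> c" "c \<le> n" and g: "\<And>y z. (\<And>i. i \<le> m \<Longrightarrow> y i = z i) \<Longrightarrow> g y = g z"
  shows "measure_pmf.expectation (uniform_coloring n q)
      (\<lambda>x. a (x c) * measure_pmf.expectation (kernel_power (systematic_scan n q) t x) g) =
    measure_pmf.expectation (uniform_coloring n q) (\<lambda>x. a (x c) * g x)"
  using assms(2,4)
proof (induction t arbitrary: m g)
  case 0
  show ?case by simp
next
  case (Suc t)
  define h where "h = (\<lambda>y. measure_pmf.expectation (systematic_scan n q y) g)"
  have "finite (set_pmf (systematic_scan n q y))" for y
    using finite_set_kernel_power_scan[of q n 1 y] q by (simp add: bind_return_pmf)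
  then have last_scan: "measure_pmf.expectation (kernel_power (systematic_scan n q) (Suc t) x) g =
      measure_pmf.expectation (kernel_power (systematic_scan n q) t x) h" for x
    using q by (simp add: expectation_bind_pmf finite_set_kernel_power_scan h_def)
  have h_cong: "h y = h z" if "\<And>i. i \<le> Suc m \<Longrightarrow> y i = z i" for y z
  proof -
    have "g (run n UNIV y U n) = g (run n UNIV z U n)" for U
      using that by (intro Suc.prems(2) run_scan_locality[of m]) auto
    then show ?thesis by (simp add: h_def systematic_scan_eq_run)
  qed
  have "measure_pmf.expectation (uniform_coloring n q)
      (\<lambda>x. a (x c) * measure_pmf.expectation (kernel_power (systematic_scan n q) (Suc t) x) g) =
    measure_pmf.expectation (uniform_coloring n q) (\<lambda>x. a (x c) * h x)"
    unfolding last_scan by (rule Suc.IH[of "Suc m" h, OF _ h_cong]) (use Suc.prems(1) in auto)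
  also have "\<dots> = measure_pmf.expectation (uniform_coloring n q) (\<lambda>x. a (x c) * g x)"
    unfolding h_def
    by (rule start_end_correlation_scan[OF q _ _ Suc.prems(2)]) (use Suc.prems(1) assms(3) in auto)
  finally show ?case .
qed

lemma stationary_match_prob:
  assumes q: "q \<ge> 2" and v: "1 \<le> v" "v + t \<le> n"
  shows "measure_pmf.expectation (uniform_coloring n q)
      (\<lambda>x. measure_pmf.prob (kernel_power (systematic_scan n q) t x) {y. y v = x (v + t)}) =
    1 / q + (1 - 1 / q) * (- 1 / (real q - 1)) ^ t"
proof -
  let ?\<pi> = "uniform_coloring n q" and ?P = "kernel_power (systematic_scan n q) t"
  let ?a = "\<lambda>r c. if c = r then 1 else 0 :: real"
  note int = integrable_measure_pmf_finite[OF finite_set_uniform_coloring[OF q]]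
  have "measure_pmf.expectation ?\<pi> (\<lambda>x. measure_pmf.prob (?P x) {y. y v = x (v + t)}) =
    measure_pmf.expectation ?\<pi> (\<lambda>x. \<Sum>r<q. ?a r (x (v + t)) * measure_pmf.expectation (?P x) (indicator {y. y v = r}))"
  proof (intro integral_cong_AE AE_pmfI)
    fix x assume "x \<in> set_pmf ?\<pi>"
    then have "x \<in> proper_colorings n q"
      using q by (simp add: set_pmf_of_set proper_colorings_nonempty finite_proper_colorings)
    then have lt: "x (v + t) < q"
      using v by (auto intro: proper_colorings_less)
    have "(\<Sum>r<q. ?a r (x (v + t)) * measure_pmf.prob (?P x) {y. y v = r}) =
        (\<Sum>r<q. if r = x (v + t) then measure_pmf.prob (?P x) {y. y v = r} else 0)"
      by (intro sum.cong) auto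
    also have "\<dots> = measure_pmf.prob (?P x) {y. y v = x (v + t)}"
      using lt by simp
    finally have "(\<Sum>r<q. ?a r (x (v + t)) * measure_pmf.prob (?P x) {y. y v = r}) =
        measure_pmf.prob (?P x) {y. y v = x (v + t)}" .
    then show "measure_pmf.prob (?P x) {y. y v = x (v + t)} =
      (\<Sum>r<q. ?a r (x (v + t)) * measure_pmf.expectation (?P x) (indicator {y. y v = r}))" by simp
  qed auto
  also have "\<dots> = (\<Sum>r<q. measure_pmf.expectation ?\<pi>
      (\<lambda>x. ?a r (x (v + t)) * measure_pmf.expectation (?P x) (indicator {y. y v = r})))"
    by (rule Bochner_Integration.integral_sum) (rule int)
  also have "\<dots> = (\<Sum>r<q. measure_pmf.expectation ?\<pi> (\<lambda>x. ?a r (x (v + t)) * indicator {y. y v = r} x))"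
    using v by (intro sum.cong refl start_end_correlation[OF q, of v t]) (auto simp: indicator_def)
  also have "\<dots> = (\<Sum>r<q. measure_pmf.prob ?\<pi> {\<sigma>. \<sigma> v = r \<and> \<sigma> (v + t) = r})"
  proof (intro sum.cong refl)
    fix r
    have "(\<lambda>x :: nat \<Rightarrow> nat. ?a r (x (v + t)) * indicator {y. y v = r} x) = indicator {\<sigma>. \<sigma> v = r \<and> \<sigma> (v + t) = r}"
      by (auto simp: indicator_def)
    then show "measure_pmf.expectation ?\<pi> (\<lambda>x. ?a r (x (v + t)) * indicator {y. y v = r} x) =
        measure_pmf.prob ?\<pi> {\<sigma>. \<sigma> v = r \<and> \<sigma> (v + t) = r}" by simp
  qed
  also have "\<dots> = (\<Sum>r<q. 1 / (real q)\<^sup>2 + (- 1 / (real q - 1)) ^ t * (1 / q - 1 / (real q)\<^sup>2))"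
    by (intro sum.cong refl, subst two_point_prob[OF q v]) auto
  also have "\<dots> = 1 / q + (1 - 1 / q) * (- 1 / (real q - 1)) ^ t"
    using q by (simp add: field_simps power2_eq_square)
  finally show ?thesis .
qed

section \<open>Frozen vertices decouple the two sides\<close>

lemma expectation_pair_pmf_mult:
  fixes f :: "'a \<Rightarrow> real" and g :: "'b \<Rightarrow> real"
  assumes "finite (set_pmf p)" "finite (set_pmf r)"
  shows "measure_pmf.expectation (pair_pmf p r) (\<lambda>(x, y). f x * g y) =
    measure_pmf.expectation p f * measure_pmf.expectation r g"
  unfolding pair_pmf_def using assms by (simp add: expectation_bind_pmf)

lemma proposals_independent:
  fixes f g :: "(nat \<Rightarrow> nat) \<Rightarrow> real"
  assumes "q > 0"
    and f: "\<And>U V. (\<And>i. i < N \<Longrightarrow> i \<in> A \<Longrightarrow> U i = V i) \<Longrightarrow> f U = f V"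
    and g: "\<And>U V. (\<And>i. i < N \<Longrightarrow> i \<notin> A \<Longrightarrow> U i = V i) \<Longrightarrow> g U = g V"
  shows "measure_pmf.expectation (proposals q N) (\<lambda>U. f U * g U) =
    measure_pmf.expectation (proposals q N) f * measure_pmf.expectation (proposals q N) g"
proof -
  define p where "p = Pi_pmf ({..<N} \<inter> A) 0 (\<lambda>_. pmf_of_set {0..<q})"
  define r where "r = Pi_pmf ({..<N} - A) 0 (\<lambda>_. pmf_of_set {0..<q})"
  define join where "join = (\<lambda>(F :: nat \<Rightarrow> nat, G) i. if i \<in> {..<N} \<inter> A then F i else G i :: nat)"
  have fin: "finite (set_pmf p)" "finite (set_pmf r)"
    using assms(1) by (auto simp: p_def r_def set_Pi_pmf set_pmf_of_set intro!: finite_PiE_dflt)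
  have split: "proposals q N = map_pmf join (pair_pmf p r)"
    using Pi_pmf_union[of "{..<N} \<inter> A" "{..<N} - A" 0 "\<lambda>_. pmf_of_set {0..<q}"]
    by (simp add: proposals_def p_def r_def join_def Int_Diff_Un Diff_Int_distrib Int_Diff)
  have "f (join X) = f (fst X)" for X by (rule f) (simp add: join_def case_prod_beta')
  moreover have "g (join X) = g (snd X)" for X by (rule g) (simp add: join_def case_prod_beta')
  ultimately have "measure_pmf.expectation (proposals q N) (\<lambda>U. f U * g U) =
      measure_pmf.expectation p f * measure_pmf.expectation r g"
    "measure_pmf.expectation (proposals q N) f = measure_pmf.expectation p f"
    "measure_pmf.expectation (proposals q N) g = measure_pmf.expectation r g"
    using expectation_pair_pmf_mult[OF fin, of f g] expectation_pair_pmf_mult[OF fin, of f "\<lambda>_. 1"]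
      expectation_pair_pmf_mult[OF fin, of "\<lambda>_. 1" g]
    by (simp_all add: split case_prod_beta')
  then show ?thesis by simp
qed

lemma proposals_independent_events:
  assumes "q > 0"
    and E: "\<And>U V. (\<And>i. i < N \<Longrightarrow> i \<in> A \<Longrightarrow> U i = V i) \<Longrightarrow> U \<in> E \<longleftrightarrow> V \<in> E"
    and F: "\<And>U V. (\<And>i. i < N \<Longrightarrow> i \<notin> A \<Longrightarrow> U i = V i) \<Longrightarrow> U \<in> F \<longleftrightarrow> V \<in> F"
  shows "measure_pmf.prob (proposals q N) (E \<inter> F) =
    measure_pmf.prob (proposals q N) E * measure_pmf.prob (proposals q N) F"
proof -
  have "measure_pmf.expectation (proposals q N) (\<lambda>U. indicator E U * indicator F U) =
    measure_pmf.expectation (proposals q N) (indicator E :: _ \<Rightarrow> real) * measure_pmf.expectation (proposals q N) (indicator F :: _ \<Rightarrow> real)"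
  proof (rule proposals_independent[OF assms(1), where A = A])
    show "indicator E U = (indicator E V :: real)" if "\<And>i. i < N \<Longrightarrow> i \<in> A \<Longrightarrow> U i = V i" for U V
      using E[OF that] by (auto simp: indicator_def)
    show "indicator F U = (indicator F V :: real)" if "\<And>i. i < N \<Longrightarrow> i \<notin> A \<Longrightarrow> U i = V i" for U V
      using F[OF that] by (auto simp: indicator_def)
  qed
  then show ?thesis by (simp flip: indicator_inter_arith)
qed

text \<open>If every proposal at \<open>w\<close> is the initial color of \<open>w\<close>, then \<open>w\<close> never changes color,
  whether or not these proposals are accepted.\<close>

definition frozen :: "nat \<Rightarrow> nat \<Rightarrow> (nat \<Rightarrow> nat) \<Rightarrow> nat \<Rightarrow> (nat \<Rightarrow> nat) set" where
  "frozen n N x w = {U. \<forall>k<N. scanned_vertex n k = w \<longrightarrow> U k = x w}"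

lemma frozen_cong:
  assumes "\<And>k. k < N \<Longrightarrow> scanned_vertex n k = w \<Longrightarrow> U k = V k"
  shows "U \<in> frozen n N x w \<longleftrightarrow> V \<in> frozen n N x w"
  using assms by (auto simp: frozen_def)

lemma card_updates_of_vertex:
  assumes "1 \<le> w" "w \<le> n"
  shows "card {k. k < T * n \<and> scanned_vertex n k = w} = T"
proof -
  have "{k. k < T * n \<and> scanned_vertex n k = w} = (\<lambda>s. s * n + (w - 1)) ` {..<T}" (is "?L = ?R")
  proof (intro equalityI subsetI)
    fix k assume "k \<in> ?L"
    then have "k = (k div n) * n + (w - 1)" "k div n < T"
      by (auto simp: scanned_vertex_def less_mult_imp_div_less)
    then show "k \<in> ?R" by blast
  next
    fix k assume "k \<in> ?R"
    then obtain s where s: "k = s * n + (w - 1)" "s < T" by blast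
    have "s * n + (w - 1) < Suc s * n" using assms by simp
    also have "\<dots> \<le> T * n" using s by (intro mult_le_mono1) simp
    finally have "k < T * n" using s by simp
    moreover have "k mod n = w - 1" unfolding s(1) mod_mult_self3 using assms by simp
    ultimately show "k \<in> ?L" using assms by (simp add: scanned_vertex_def)
  qed
  moreover have "inj_on (\<lambda>s. s * n + (w - 1)) {..<T}"
    using assms by (intro inj_onI) (simp only: add_right_cancel mult_cancel2, simp)
  ultimately show ?thesis by (simp add: card_image)
qed

lemma prob_frozen:
  assumes "1 \<le> w" "w \<le> n" "x w < q"
  shows "measure_pmf.prob (proposals q (T * n)) (frozen n (T * n) x w) = 1 / real q ^ T"
proof -
  define B where "B = (\<lambda>k. if scanned_vertex n k = w then {x w} else UNIV)"
  have "frozen n (T * n) x w = Pi {..<T * n} B"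
    by (auto simp: frozen_def B_def Pi_def)
  then have "measure_pmf.prob (proposals q (T * n)) (frozen n (T * n) x w) =
      (\<Prod>k<T * n. measure_pmf.prob (pmf_of_set {0..<q}) (B k))"
    unfolding proposals_def by (simp add: measure_Pi_pmf_Pi)
  also have "\<dots> = (\<Prod>k<T * n. if scanned_vertex n k = w then 1 / real q else 1)"
    using assms(3) by (intro prod.cong) (auto simp: B_def measure_pmf_of_set)
  also have "\<dots> = (\<Prod>k | k < T * n \<and> scanned_vertex n k = w. 1 / real q)"
    by (simp add: prod.If_cases Int_def)
  also have "\<dots> = 1 / real q ^ T"
    using card_updates_of_vertex[OF assms(1,2), of T] by (simp add: power_divide)
  finally show ?thesis .
qed

lemma prob_none_frozen:
  assumes "finite A" "A \<subseteq> {1..n}" "\<And>w. w \<in> A \<Longrightarrow> x w < q" "q > 0"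
  shows "measure_pmf.prob (proposals q (T * n)) (\<Inter>w\<in>A. - frozen n (T * n) x w) = (1 - 1 / real q ^ T) ^ card A"
  using assms(1-3)
proof (induction A)
  case (insert w A)
  let ?p = "proposals q (T * n)"
  have "measure_pmf.prob ?p (- frozen n (T * n) x w \<inter> (\<Inter>w\<in>A. - frozen n (T * n) x w)) =
    measure_pmf.prob ?p (- frozen n (T * n) x w) * measure_pmf.prob ?p (\<Inter>w\<in>A. - frozen n (T * n) x w)"
  proof (rule proposals_independent_events[OF assms(4), of _ "{k. scanned_vertex n k = w}"])
    fix U V :: "nat \<Rightarrow> nat"
    assume UV: "U k = V k" if "k < T * n" "k \<in> {k. scanned_vertex n k = w}" for k
    have "U \<in> frozen n (T * n) x w \<longleftrightarrow> V \<in> frozen n (T * n) x w"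
      by (intro frozen_cong UV) auto
    then show "U \<in> - frozen n (T * n) x w \<longleftrightarrow> V \<in> - frozen n (T * n) x w" by blast
  next
    fix U V :: "nat \<Rightarrow> nat"
    assume UV: "U k = V k" if "k < T * n" "k \<notin> {k. scanned_vertex n k = w}" for k
    have "U \<in> frozen n (T * n) x w' \<longleftrightarrow> V \<in> frozen n (T * n) x w'" if "w' \<in> A" for w'
      using that insert.hyps by (intro frozen_cong UV) auto
    then show "U \<in> (\<Inter>w\<in>A. - frozen n (T * n) x w) \<longleftrightarrow> V \<in> (\<Inter>w\<in>A. - frozen n (T * n) x w)" by blast
  qed
  also have "measure_pmf.prob ?p (- frozen n (T * n) x w) = 1 - 1 / real q ^ T"
    using insert.prems measure_pmf.prob_compl[of "frozen n (T * n) x w" ?p] prob_frozen[of w n x q T]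
    by (simp add: Compl_eq_Diff_UNIV)
  also have "measure_pmf.prob ?p (\<Inter>w\<in>A. - frozen n (T * n) x w) = (1 - 1 / real q ^ T) ^ card A"
    using insert.prems by (intro insert.IH) auto
  finally show ?case using insert.hyps by simp
qed simp

text \<open>A vertex between \<open>u\<close> and \<open>w\<close> only looks at vertices in \<open>{u..w}\<close>, and the two frozen ends show the
  same colors in both runs.\<close>

lemma run_between_frozen:
  assumes "U \<in> frozen n N x u" "U \<in> frozen n N x w" "{u..w} \<subseteq> W" "k \<le> N" "i \<in> {u..w}"
  shows "run n UNIV x U k i = run n W x U k i"
proof -
  have "(\<forall>i\<in>{u..w}. run n UNIV x U k i = run n W x U k i) \<and>
      run n UNIV x U k u = x u \<and> run n UNIV x U k w = x w"
    using assms(4)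
  proof (induction k)
    case (Suc k)
    let ?v = "scanned_vertex n k"
    let ?X = "run n UNIV x U k" and ?Z = "run n W x U k"
    have IH: "\<And>i. i \<in> {u..w} \<Longrightarrow> ?X i = ?Z i" "?X u = x u" "?X w = x w"
      using Suc by auto
    have ends: "?X j = x j" "?v = j \<Longrightarrow> U k = x j" if "j = u \<or> j = w" for j
      using that IH(2,3) assms(1,2) Suc.prems by (auto simp: frozen_def)
    have "run n UNIV x U (Suc k) j = x j" if "j = u \<or> j = w" for j
    proof (cases "?v = j")
      case True
      then show ?thesis using ends[OF that] by (simp add: recolor_same)
    next
      case False
      then show ?thesis using ends(1)[OF that] by (simp add: recolor_other)
    qed
    moreover have "run n UNIV x U (Suc k) i = run n W x U (Suc k) i" if i: "i \<in> {u..w}" for i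
    proof (cases "?v = i")
      case False
      then show ?thesis using IH(1)[OF i] by (simp add: recolor_other)
    next
      case True
      then have "?v \<in> W" using i assms(3) by auto
      show ?thesis
      proof (cases "i = u \<or> i = w")
        case True
        then have "U k = x i" "?X i = x i" using ends \<open>?v = i\<close> by blast+
        then show ?thesis using \<open>?v = i\<close> IH(1)[OF i] by (simp add: recolor_same)
      next
        case False
        have "recolor n i (U k) ?X i = recolor n i (U k) ?Z i"
          by (rule recolor_cong; rule IH(1)) (use False i in auto)
        then show ?thesis using \<open>?v \<in> W\<close> \<open>?v = i\<close> by simp
      qed
    qed
    ultimately show ?case by blast
  qed simp
  then show ?thesis using assms(5) by blast
qed

text \<open>Events that coincide with independent ones outside bad sets of probability \<open>\<rho>\<close>: replacing the
  joint probability costs \<open>2 \<rho>\<close>, and so does replacing the product.\<close>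

lemma covariance_of_approximations:
  fixes p :: "'a pmf"
  assumes indep: "measure_pmf.prob p (E' \<inter> F') = measure_pmf.prob p E' * measure_pmf.prob p F'"
    and E: "\<And>U. U \<notin> B \<Longrightarrow> U \<in> E \<longleftrightarrow> U \<in> E'" and F: "\<And>U. U \<notin> C \<Longrightarrow> U \<in> F \<longleftrightarrow> U \<in> F'"
    and B: "measure_pmf.prob p B \<le> \<rho>" and C: "measure_pmf.prob p C \<le> \<rho>"
  shows "measure_pmf.prob p (E \<inter> F) - measure_pmf.prob p E * measure_pmf.prob p F \<le> 4 * \<rho>"
proof -
  let ?P = "measure_pmf.prob p"
  have sub: "?P X \<le> ?P Y + ?P Z" if "X \<subseteq> Y \<union> Z" for X Y Z
    using measure_pmf.finite_measure_mono[of X "Y \<union> Z" p] measure_Un_le[of Y p Z] that by simp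
  have "?P (E \<inter> F) \<le> ?P (E' \<inter> F') + ?P (B \<union> C)" using E F by (intro sub) auto
  moreover have "?P (B \<union> C) \<le> ?P B + ?P C" by (intro sub) auto
  ultimately have 1: "?P (E \<inter> F) \<le> ?P E' * ?P F' + 2 * \<rho>" using B C indep by linarith
  have "?P E' \<le> ?P E + ?P B" using E by (intro sub) auto
  then have E': "?P E' \<le> ?P E + \<rho>" using B by linarith
  have "?P F' \<le> ?P F + ?P C" using F by (intro sub) auto
  then have F': "?P F' \<le> ?P F + \<rho>" using C by linarith
  have "0 \<le> \<rho>" using B measure_nonneg[of p B] by linarith
  have "?P E' * ?P F' \<le> (?P E + \<rho>) * ?P F'" using E' by (intro mult_right_mono) auto
  also have "\<dots> \<le> ?P E * ?P F' + \<rho>"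
    using mult_left_le[of "?P F'" \<rho>] \<open>0 \<le> \<rho>\<close> by (simp add: distrib_right)
  also have "?P E * ?P F' \<le> ?P E * (?P F + \<rho>)" using F' by (intro mult_left_mono) auto
  also have "\<dots> \<le> ?P E * ?P F + \<rho>"
    using mult_left_le_one_le[of \<rho> "?P E"] \<open>0 \<le> \<rho>\<close> by (simp add: distrib_left)
  finally show ?thesis using 1 by linarith
qed

text \<open>Let the window of a vertex consist of the vertices at distance at most \<open>l\<close>. Unless one half of it has
  no frozen vertex, the final color of its centre is that of the chain restricted to the window, and
  the restricted chains in disjoint windows use disjoint sets of proposals.\<close>

lemma scan_covariance:
  fixes T :: nat
  assumes q: "q \<ge> 1" and x: "x \<in> proper_colorings n q"
    and u: "l < u" "u + l \<le> n" and v: "l < v" "v + l \<le> n" and disj: "{u - l..u + l} \<inter> {v - l..v + l} = {}"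
  defines "P \<equiv> kernel_power (systematic_scan n q) T x"
  shows "measure_pmf.prob P ({y. y u = a} \<inter> {y. y v = b}) - measure_pmf.prob P {y. y u = a} * measure_pmf.prob P {y. y v = b}
    \<le> 8 * (1 - 1 / real q ^ T) ^ l"
proof -
  let ?N = "T * n"
  let ?p = "proposals q ?N"
  define window where "window = (\<lambda>u. {u - l..u + l})"
  define bad where "bad = (\<lambda>u. (\<Inter>w\<in>{u - l..<u}. - frozen n ?N x w) \<union> (\<Inter>w\<in>{u<..u + l}. - frozen n ?N x w))"
  have local: "run n UNIV x U ?N u = run n (window u) x U ?N u" if "U \<notin> bad u" for U u
  proof -
    obtain w w' where w: "w \<in> {u - l..<u}" "w' \<in> {u<..u + l}" "U \<in> frozen n ?N x w" "U \<in> frozen n ?N x w'"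
      using \<open>U \<notin> bad u\<close> by (auto simp: bad_def)
    then show ?thesis by (intro run_between_frozen[OF w(3,4)]) (auto simp: window_def)
  qed
  have bad: "measure_pmf.prob ?p (bad u) \<le> 2 * (1 - 1 / real q ^ T) ^ l" if "l < u" "u + l \<le> n" for u
  proof -
    have "x w < q" if "w \<in> {1..n}" for w using that x by (auto intro: proper_colorings_less)
    then have "measure_pmf.prob ?p (\<Inter>w\<in>A. - frozen n ?N x w) = (1 - 1 / real q ^ T) ^ card A" if "A \<subseteq> {1..n}" for A
      using q that finite_subset[OF that] by (intro prob_none_frozen) auto
    from this[of "{u - l..<u}"] this[of "{u<..u + l}"] show ?thesis
      using that measure_Un_le[of "\<Inter>w\<in>{u - l..<u}. - frozen n ?N x w" ?p "\<Inter>w\<in>{u<..u + l}. - frozen n ?N x w"]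
      by (fastforce simp: bad_def)
  qed
  have "measure_pmf.prob ?p ({U. run n UNIV x U ?N u = a} \<inter> {U. run n UNIV x U ?N v = b}) -
      measure_pmf.prob ?p {U. run n UNIV x U ?N u = a} * measure_pmf.prob ?p {U. run n UNIV x U ?N v = b}
    \<le> 4 * (2 * (1 - 1 / real q ^ T) ^ l)"
  proof (rule covariance_of_approximations[OF _ _ _ bad[OF u] bad[OF v]])
    show "measure_pmf.prob ?p ({U. run n (window u) x U ?N u = a} \<inter> {U. run n (window v) x U ?N v = b}) =
        measure_pmf.prob ?p {U. run n (window u) x U ?N u = a} * measure_pmf.prob ?p {U. run n (window v) x U ?N v = b}"
    proof (rule proposals_independent_events[where A = "{k. scanned_vertex n k \<in> window u}"])
      fix U V :: "nat \<Rightarrow> nat"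
      assume UV: "U i = V i" if "i < ?N" "i \<notin> {k. scanned_vertex n k \<in> window u}" for i
      have "run n (window v) x U ?N = run n (window v) x V ?N"
        using disj by (intro run_proposals_cong UV) (auto simp: window_def)
      then show "U \<in> {U. run n (window v) x U ?N v = b} \<longleftrightarrow> V \<in> {U. run n (window v) x U ?N v = b}" by simp
    next
      fix U V :: "nat \<Rightarrow> nat"
      assume UV: "U i = V i" if "i < ?N" "i \<in> {k. scanned_vertex n k \<in> window u}" for i
      have "run n (window u) x U ?N = run n (window u) x V ?N"
        by (intro run_proposals_cong UV) auto
      then show "U \<in> {U. run n (window u) x U ?N u = a} \<longleftrightarrow> V \<in> {U. run n (window u) x U ?N u = a}" by simp
    qed (use q in auto)
  qed (use local in auto)
  moreover have "(\<lambda>U. run n UNIV x U ?N) -` {y. y i = c} = {U. run n UNIV x U ?N i = c}" for i c by auto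
  ultimately show ?thesis unfolding P_def kernel_power_eq_run measure_map_pmf vimage_Int by simp
qed

section \<open>Distinguishing the scan from stationarity\<close>

lemma uniform_covariance:
  assumes q: "q \<ge> 2" and "1 \<le> u" "u + k \<le> n" "a < q" "b < q"
  shows "measure_pmf.prob (uniform_coloring n q) ({y. y u = a} \<inter> {y. y (u + k) = b}) -
    measure_pmf.prob (uniform_coloring n q) {y. y u = a} * measure_pmf.prob (uniform_coloring n q) {y. y (u + k) = b}
    \<le> (1 / (real q - 1)) ^ k"
proof -
  have "measure_pmf.prob (uniform_coloring n q) ({y. y u = a} \<inter> {y. y (u + k) = b}) -
    measure_pmf.prob (uniform_coloring n q) {y. y u = a} * measure_pmf.prob (uniform_coloring n q) {y. y (u + k) = b} =
    (- 1 / (real q - 1)) ^ k * ((if a = b then 1 / q else 0) - 1 / (real q)\<^sup>2)" (is "_ = ?r * ?d")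
    using two_point_prob[OF assms] one_point_prob[OF q, of u n a] one_point_prob[OF q, of "u + k" n b] assms(2-)
    by (simp add: Collect_conj_eq[symmetric] power2_eq_square)
  also have "\<dots> \<le> \<bar>?r\<bar> * \<bar>?d\<bar>" by (metis abs_ge_self abs_mult)
  also have "\<dots> \<le> (1 / (real q - 1)) ^ k * 1"
  proof (intro mult_mono)
    have *: "1 / real q \<le> 1" "0 \<le> 1 / (real q)\<^sup>2" "1 / (real q)\<^sup>2 \<le> 1 / q"
      using q by (auto simp: field_simps power2_eq_square)
    have "\<bar>1 / q - 1 / (real q)\<^sup>2\<bar> \<le> 1" "\<bar>0 - 1 / (real q)\<^sup>2\<bar> \<le> 1"
      using * by linarith+
    then show "\<bar>?d\<bar> \<le> 1" by (simp only: split: if_split) simp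
  qed (use q in \<open>auto simp: power_abs\<close>)
  finally show ?thesis by simp
qed

lemma exists_ge_average:
  fixes f :: "(nat \<Rightarrow> nat) \<Rightarrow> real"
  assumes q: "q \<ge> 2"
  obtains x where "x \<in> proper_colorings n q" "f x \<ge> measure_pmf.expectation (uniform_coloring n q) f"
proof -
  let ?S = "proper_colorings n q" and ?\<mu> = "measure_pmf.expectation (uniform_coloring n q) f"
  note S = finite_proper_colorings[of n q] proper_colorings_nonempty[OF q, of n]
  have "\<exists>x\<in>?S. f x \<ge> ?\<mu>"
  proof (rule ccontr)
    assume "\<not> (\<exists>x\<in>?S. f x \<ge> ?\<mu>)"
    then have "(\<Sum>x\<in>?S. f x) < (\<Sum>x\<in>?S. ?\<mu>)" using S by (intro sum_strict_mono) auto
    then show False using S by (simp add: integral_pmf_of_set)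
  qed
  then show thesis using that by blast
qed

text \<open>The distinguishing event says that the colors at the window centres \<open>v j\<close> agree with the initial
  colors at \<open>v j + T\<close> unusually often, namely at least halfway between the two means. A good start
  exists because the stationary average of the expected count is known. Evenness of \<open>T\<close> makes the
  bias \<open>\<kappa>\<close> positive.\<close>

lemma scan_distinguished:
  fixes q n m l T :: nat
  assumes q: "q \<ge> 3" and T: "even T" "0 < T" "T \<le> l" and m: "0 < m" "m * (2 * l + 1) \<le> n"
  defines "\<kappa> \<equiv> (1 - 1 / real q) / (real q - 1) ^ T" and "\<eta> \<equiv> 8 * (1 - 1 / real q ^ T) ^ l"
  obtains x A where "x \<in> proper_colorings n q"
    "measure_pmf.prob (kernel_power (systematic_scan n q) T x) A - measure_pmf.prob (uniform_coloring n q) A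
      \<ge> 1 - 8 * (1 / real m + \<eta>) / \<kappa>\<^sup>2"
proof -
  let ?\<pi> = "uniform_coloring n q" and ?K = "kernel_power (systematic_scan n q) T"
  have q2: "q \<ge> 2" using q by simp
  define v where "v = (\<lambda>j. j * (2 * l + 1) + (l + 1))"
  have v_mono: "v i + (2 * l + 1) \<le> v j" if "i < j" for i j
  proof -
    have "Suc i * (2 * l + 1) \<le> j * (2 * l + 1)" using that by (intro mult_le_mono1) simp
    then show ?thesis by (simp add: v_def)
  qed
  have v: "l < v j" "v j + l \<le> n" if "j < m" for j
  proof -
    have "Suc j * (2 * l + 1) \<le> m * (2 * l + 1)" using that by (intro mult_le_mono1) simp
    then show "v j + l \<le> n" using m(2) by (simp add: v_def)
  qed (simp add: v_def)
  have \<kappa>: "\<kappa> > 0" using q by (simp add: \<kappa>_def)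
  have "1 / real q ^ T \<le> 1" using q by simp
  then have \<eta>: "\<eta> \<ge> 0" by (simp add: \<eta>_def)

  \<comment> \<open>The expected number of matches for the start \<open>x\<close>.\<close>
  define f where "f = (\<lambda>x. \<Sum>j<m. measure_pmf.prob (?K x) {y. y (v j) = x (v j + T)})"
  have "measure_pmf.expectation ?\<pi> f =
      (\<Sum>j<m. measure_pmf.expectation ?\<pi> (\<lambda>x. measure_pmf.prob (?K x) {y. y (v j) = x (v j + T)}))"
    unfolding f_def
    by (intro Bochner_Integration.integral_sum integrable_measure_pmf_finite finite_set_uniform_coloring q2)
  also have "\<dots> = (\<Sum>j<m. 1 / q + \<kappa>)"
  proof (intro sum.cong refl)
    fix j assume "j \<in> {..<m}"
    then have "1 \<le> v j" "v j + T \<le> n" using v[of j] T(3) by auto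
    from stationary_match_prob[OF q2 this] T(1)
    show "measure_pmf.expectation ?\<pi> (\<lambda>x. measure_pmf.prob (?K x) {y. y (v j) = x (v j + T)}) = 1 / q + \<kappa>"
      by (simp add: \<kappa>_def power_divide)
  qed
  finally have mean: "measure_pmf.expectation ?\<pi> f = m / q + m * \<kappa>" by (simp add: distrib_left)
  obtain x where x: "x \<in> proper_colorings n q" "f x \<ge> m / q + m * \<kappa>"
    using exists_ge_average[OF q2, of n f] mean by metis

  define E where "E = (\<lambda>j. {y :: nat \<Rightarrow> nat. y (v j) = x (v j + T)})"
  define C where "C = (\<lambda>y. \<Sum>j<m. indicator (E j) y :: real)"
  define A where "A = {y. C y \<ge> m / q + m * \<kappa> / 2}"
  define \<delta> where "\<delta> = (m + m\<^sup>2 * \<eta>) / (m * \<kappa> / 2)\<^sup>2"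
  have a: "m * \<kappa> / 2 > 0" using m \<kappa> by simp

  have "measure_pmf.prob (?K x) (- A) \<le> measure_pmf.prob (?K x) {y. \<bar>C y - f x\<bar> \<ge> m * \<kappa> / 2}"
  proof (intro measure_pmf.finite_measure_mono subsetI CollectI)
    fix y assume "y \<in> - A"
    then have "C y < m / q + m * \<kappa> / 2" by (simp add: A_def)
    then show "m * \<kappa> / 2 \<le> \<bar>C y - f x\<bar>" using x(2) by linarith
  qed simp
  also have "\<dots> \<le> \<delta>"
  proof -
    have "measure_pmf.prob (?K x) (E i \<inter> E j) - measure_pmf.prob (?K x) (E i) * measure_pmf.prob (?K x) (E j) \<le> \<eta>"
      if "i < m" "j < m" "i \<noteq> j" for i j
    proof -
      have "{v i - l..v i + l} \<inter> {v j - l..v j + l} = {}"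
        using v_mono[of i j] v_mono[of j i] \<open>i \<noteq> j\<close> by (cases "i < j") auto
      then show ?thesis unfolding E_def \<eta>_def
        using q x(1) v that by (intro scan_covariance) auto
    qed
    then show ?thesis
      using count_concentration[of "?K x" "{..<m}" "m * \<kappa> / 2" \<eta> E] a \<eta> q
      by (simp add: \<delta>_def C_def f_def E_def finite_set_kernel_power_scan)
  qed
  finally have scan: "measure_pmf.prob (?K x) A \<ge> 1 - \<delta>"
    using measure_pmf.prob_compl[of A "?K x"] by (simp add: Compl_eq_Diff_UNIV)

  have color: "x (v j + T) < q" if "j < m" for j
    using v[OF that] T(3) by (intro proper_colorings_less[OF x(1)]) auto
  have one: "measure_pmf.prob ?\<pi> (E j) = 1 / q" if "j < m" for j
    unfolding E_def using v[OF that] color[OF that] by (intro one_point_prob[OF q2]) auto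
  have "measure_pmf.prob ?\<pi> A \<le> measure_pmf.prob ?\<pi> {y. \<bar>C y - (\<Sum>j<m. measure_pmf.prob ?\<pi> (E j))\<bar> \<ge> m * \<kappa> / 2}"
  proof (intro measure_pmf.finite_measure_mono subsetI CollectI)
    fix y assume "y \<in> A"
    then have "m / q + m * \<kappa> / 2 \<le> C y" by (simp add: A_def)
    moreover have "(\<Sum>j<m. measure_pmf.prob ?\<pi> (E j)) = m / q" using one by simp
    ultimately show "m * \<kappa> / 2 \<le> \<bar>C y - (\<Sum>j<m. measure_pmf.prob ?\<pi> (E j))\<bar>" by linarith
  qed simp
  also have "\<dots> \<le> \<delta>"
  proof -
    have le: "measure_pmf.prob ?\<pi> (E i \<inter> E j) - measure_pmf.prob ?\<pi> (E i) * measure_pmf.prob ?\<pi> (E j) \<le> \<eta>"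
      if "i < j" "j < m" for i j
    proof -
      define k where "k = v j - v i"
      have k: "v j = v i + k" "l \<le> k" using v_mono[OF \<open>i < j\<close>] by (auto simp: k_def)
      have "measure_pmf.prob ?\<pi> (E i \<inter> E j) - measure_pmf.prob ?\<pi> (E i) * measure_pmf.prob ?\<pi> (E j)
          \<le> (1 / (real q - 1)) ^ k"
        unfolding E_def k(1)
        using v[of i] v[of j] color[of i] color[of j] that k
        by (intro uniform_covariance[OF q2]) auto
      also have "\<dots> \<le> (1 / (real q - 1)) ^ l"
        using k(2) q by (intro power_decreasing) auto
      also have "\<dots> \<le> (1 - 1 / real q ^ T) ^ l"
      proof (intro power_mono)
        have "3 \<le> real q ^ 1" using q by simp
        also have "\<dots> \<le> real q ^ T" using q T by (intro power_increasing) auto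
        finally have "1 / real q ^ T \<le> 1 / 3" using q by (intro divide_left_mono) auto
        moreover have "1 / (real q - 1) \<le> 1 / 2" using q by (intro divide_left_mono) auto
        ultimately show "1 / (real q - 1) \<le> 1 - 1 / real q ^ T" by linarith
      qed (use q in auto)
      also have "\<dots> \<le> \<eta>" using \<open>1 / real q ^ T \<le> 1\<close> by (simp add: \<eta>_def)
      finally show ?thesis .
    qed
    have "measure_pmf.prob ?\<pi> (E i \<inter> E j) - measure_pmf.prob ?\<pi> (E i) * measure_pmf.prob ?\<pi> (E j) \<le> \<eta>"
      if "i < m" "j < m" "i \<noteq> j" for i j
      using le[of i j] le[of j i] that by (cases "i < j") (auto simp: Int_commute mult.commute)
    then show ?thesis
      using count_concentration[of ?\<pi> "{..<m}" "m * \<kappa> / 2" \<eta> E] a \<eta> q2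
      by (simp add: \<delta>_def C_def finite_set_uniform_coloring)
  qed
  finally have unif: "measure_pmf.prob ?\<pi> A \<le> \<delta>" .

  have "2 * \<delta> = 8 * (1 / real m + \<eta>) / \<kappa>\<^sup>2"
    using m(1) \<kappa> by (simp add: \<delta>_def field_simps power2_eq_square)
  then show thesis using that[OF x(1), of A] scan unif by linarith
qed

theorem theorem23:
  fixes q :: nat and \<epsilon> :: real
  assumes "q \<ge> 4" and "\<epsilon> < 1"
  shows "\<forall>\<^sub>F n in sequentially.
    ereal_of_enat
      (Mix (proper_colorings n q) (systematic_scan n q) (pmf_of_set (proper_colorings n q)) \<epsilon>)
    \<ge> ereal (1 / 2 * (1 / 3 * log (real q - 1) (real n) - 2))"
proof -
  \<comment> \<open>\<open>?M\<close> is a lower bound for the number of windows, \<open>8 * ?e\<close> an upper bound for the covariances,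
    and \<open>?R\<close> the resulting upper bound for the error in \<open>scan_distinguished\<close>.\<close>
  let ?M = "\<lambda>n. real n / (2 * sqrt (real n) + 1) - 1"
  let ?e = "\<lambda>n. exp (- ((sqrt (real n) - 1) / real n powr (1/3)))"
  let ?R = "\<lambda>n. 32 * real n powr (1/3) * (1 / ?M n + 8 * ?e n)"
  have "?R \<longlonglongrightarrow> 0" by real_asymp
  then have "\<forall>\<^sub>F n in sequentially. ?R n < 1 - \<epsilon>"
    using assms(2) by (intro order_tendstoD(2)) auto
  moreover have "\<forall>\<^sub>F n in sequentially. ?M n > 0" by real_asymp
  moreover have "\<forall>\<^sub>F n in sequentially. real n powr (1/6) \<le> sqrt (real n) - 1" by real_asymp
  moreover have "\<forall>\<^sub>F n in sequentially. (q - 1) ^ 12 \<le> n" by (rule eventually_ge_at_top)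
  ultimately show ?thesis
  proof eventually_elim
    case (elim n)
    define L where "L = log (real q - 1) (real n)"
    \<comment> \<open>\<open>T + 1\<close> exceeds the claimed bound \<open>L / 6 - 1\<close>, so every time below that bound is at most \<open>T\<close>,
      whereas \<open>T \<le> L / 6\<close> keeps \<open>(q - 1) ^ T\<close> below the sixth root of \<open>n\<close>.\<close>
    define T where "T = 2 * nat \<lfloor>L / 12\<rfloor>"
    define l where "l = nat \<lfloor>sqrt (real n)\<rfloor>"
    define m where "m = n div (2 * l + 1)"
    define \<kappa> where "\<kappa> = (1 - 1 / real q) / (real q - 1) ^ T"
    define \<eta> where "\<eta> = 8 * (1 - 1 / real q ^ T) ^ l"
    have q1: "real q - 1 > 1" using assms by simp
    have "0 < (q - 1) ^ 12" using assms by simp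
    then have n: "n > 0" using elim(4) by linarith
    have "real ((q - 1) ^ 12) \<le> real n" using elim(4) by (simp only: of_nat_le_iff)
    then have "(real q - 1) ^ 12 \<le> real n" using assms by (simp add: of_nat_diff)
    then have "log (real q - 1) ((real q - 1) ^ 12) \<le> L"
      unfolding L_def using q1 n by (intro log_mono) auto
    then have L: "L \<ge> 12" using q1 by (simp add: log_nat_power)
    then have T: "0 < T" "real T \<le> L / 6" "L / 6 - 2 < real T" by (auto simp: T_def) linarith+
    have "(real q - 1) ^ T = (real q - 1) powr real T" using q1 by (simp add: powr_realpow)
    also have "\<dots> \<le> (real q - 1) powr (L / 6)" using q1 T by (intro powr_mono) auto
    also have "\<dots> = ((real q - 1) powr L) powr (1/6)" by (simp add: powr_powr)
    also have "(real q - 1) powr L = real n" unfolding L_def using q1 n by simp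
    finally have qT: "(real q - 1) ^ T \<le> real n powr (1/6)" .
    \<comment> \<open>Squaring \<open>q - 1\<close> more than makes up for the difference between \<open>q\<close> and \<open>q - 1\<close>.\<close>
    have "real q ^ T \<le> ((real q - 1)\<^sup>2) ^ T"
    proof (intro power_mono)
      have "3 * (real q - 1) \<le> (real q - 1) * (real q - 1)" using assms by (intro mult_right_mono) auto
      moreover have "real q \<le> 3 * (real q - 1)" using assms by simp
      ultimately show "real q \<le> (real q - 1)\<^sup>2" unfolding power2_eq_square by (rule order_trans[rotated])
    qed simp
    also have "\<dots> = ((real q - 1) ^ T)\<^sup>2" by (simp add: power_mult[symmetric] mult.commute)
    also have "\<dots> \<le> (real n powr (1/6))\<^sup>2" using qT q1 by (intro power_mono) auto
    also have "\<dots> = real n powr (1/3)" by (simp add: power2_eq_square flip: powr_add)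
    finally have qT2: "real q ^ T \<le> real n powr (1/3)" .
    have l: "real l \<le> sqrt (real n)" "sqrt (real n) - 1 \<le> real l" by (auto simp: l_def)
    have "real T \<le> (real q - 1) ^ T"
    proof -
      have "real T \<le> real (2 ^ T)" by (simp only: of_nat_le_iff) (simp add: less_imp_le)
      also have "\<dots> \<le> (real q - 1) ^ T" using assms by (simp, intro power_mono) auto
      finally show ?thesis .
    qed
    then have Tl: "T \<le> l" using qT elim(3) l by linarith
    have "?M n \<le> real n / (2 * real l + 1) - 1"
      using l(1) by (intro diff_right_mono divide_left_mono) auto
    also have "\<dots> \<le> real m"
    proof -
      have "\<lfloor>real n / real (2 * l + 1)\<rfloor> = int m"
        unfolding m_def by (rule floor_divide_of_nat_eq)
      then have "real n / real (2 * l + 1) < real m + 1" by (simp only: floor_eq_iff) simp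
      then show ?thesis by (simp add: add.commute)
    qed
    finally have m: "?M n \<le> real m" .
    have "1 / 2 \<le> 1 - 1 / real q" using assms by (simp add: field_simps)
    then have "1 / 2 / real n powr (1/6) \<le> \<kappa>"
      unfolding \<kappa>_def using qT q1 n by (intro frac_le) auto
    then have "(1 / 2 / real n powr (1/6))\<^sup>2 \<le> \<kappa>\<^sup>2" using n by (intro power_mono) auto
    moreover have "(1 / 2 / real n powr (1/6))\<^sup>2 = 1 / (4 * real n powr (1/3))"
      by (simp add: power2_eq_square flip: powr_add)
    ultimately have \<kappa>: "1 / (4 * real n powr (1/3)) \<le> \<kappa>\<^sup>2" by simp
    have "(1 - 1 / real q ^ T) ^ l \<le> (exp (- 1 / real q ^ T)) ^ l"
      using assms exp_ge_add_one_self[of "- 1 / real q ^ T"] by (intro power_mono) auto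
    also have "\<dots> = exp (- (real l / real q ^ T))" by (simp flip: exp_of_nat_mult)
    also have "\<dots> \<le> ?e n"
    proof -
      have "(sqrt (real n) - 1) / real n powr (1/3) \<le> real l / real q ^ T"
        using l(2) qT2 assms by (intro frac_le) auto
      then show ?thesis by simp
    qed
    finally have \<eta>: "\<eta> \<le> 8 * ?e n" by (simp add: \<eta>_def)
    have "0 \<le> \<eta>" using assms by (simp add: \<eta>_def)
    have "1 / real m \<le> 1 / ?M n" using m elim(2) by (intro divide_left_mono) auto
    then have "8 * (1 / real m + \<eta>) \<le> 8 * (1 / ?M n + 8 * ?e n)"
      using \<eta> by (intro mult_left_mono add_mono) simp_all
    moreover have "0 \<le> 8 * (1 / ?M n + 8 * ?e n)" using elim(2) by simp
    ultimately have "8 * (1 / real m + \<eta>) / \<kappa>\<^sup>2 \<le> 8 * (1 / ?M n + 8 * ?e n) / (1 / (4 * real n powr (1/3)))"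
      using \<kappa> n by (intro frac_le) auto
    also have "\<dots> = ?R n" by simp
    also have "\<dots> < 1 - \<epsilon>" by (rule elim(1))
    finally have small: "8 * (1 / real m + \<eta>) / \<kappa>\<^sup>2 < 1 - \<epsilon>" .

    have "real m > 0" using m elim(2) by linarith
    then have m_pos: "0 < m" by simp
    have windows_fit: "m * (2 * l + 1) \<le> n" unfolding m_def by (rule div_times_less_eq_dividend)
    have q3: "q \<ge> 3" and "even T" using assms by (auto simp: T_def)
    from scan_distinguished[OF q3 this(2) T(1) Tl m_pos windows_fit, folded \<kappa>_def \<eta>_def]
    obtain x A where x: "x \<in> proper_colorings n q" and
      A: "measure_pmf.prob (kernel_power (systematic_scan n q) T x) A - measure_pmf.prob (uniform_coloring n q) A
        \<ge> 1 - 8 * (1 / real m + \<eta>) / \<kappa>\<^sup>2"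
      .
    show ?case
    proof (rule Mix_ge[OF finite_proper_colorings x])
      fix t :: nat assume t: "dTV (proper_colorings n q) (kernel_power (systematic_scan n q) t x) (uniform_coloring n q) \<le> \<epsilon>"
      \<comment> \<open>The event separates at time \<open>T\<close>, hence at every earlier time with the same start \<open>x\<close>.\<close>
      have "\<not> t \<le> T"
      proof
        assume "t \<le> T"
        then have "measure_pmf.expectation (kernel_power (systematic_scan n q) T x) (indicator A) -
          measure_pmf.expectation (uniform_coloring n q) (indicator A :: _ \<Rightarrow> real)
          \<le> dTV (proper_colorings n q) (kernel_power (systematic_scan n q) t x) (uniform_coloring n q)"
          using assms x systematic_scan_closed[of q _ n] systematic_scan_stationary[of q n]
          by (intro later_test_le_dTV)
            (auto simp: finite_proper_colorings proper_colorings_nonempty set_pmf_of_set indicator_def)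
        then show False using A small t by simp
      qed
      then show "1 / 2 * (1 / 3 * log (real q - 1) (real n) - 2) \<le> real t"
        using T(3) unfolding L_def by simp
    qed
  qed
qed

end
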